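(* Let $\alpha,\beta>-1$, let $\mu\ge0$ be an integer, let $g\in C^\infty[-1,1]$, and let $\mathcal P_N^{f,Ja}$ denote the Jacobi orthogonal projection of $f$ with parameters $(\alpha,\beta)$. Then, as $N\to\infty$, the following hold. (i) If $f(x)=(1-x)^{\gamma}\ln^{\mu}(1-x)\,g(x)$ with $\gamma\in\mathbb R$ and $\min\{\alpha+\gamma,\alpha+2\gamma\}>-1$, then $$\|f-\mathcal P_N^{f,Ja}\|_{L^2_\omega[-1,1]}=O\big(N^{-\alpha-2\gamma-1}\ln^{\mu}(N)\big).$$ (ii) If $f(x)=|x-z_0|^{s}\ln^{\mu}|x-z_0|\,g(x)$ with $z_0\in(-1,1)$, $s>-\frac12$ and $\min\{\alpha,\beta\}\ge-\frac12$, then $$\|f-\mathcal P_N^{f,Ja}\|_{L^2_\omega[-1,1]}=O\big(N^{-s-1/2}\ln^{\mu}(N)\big).$$ (iii) If $f(x)=(1+x)^{\delta}\ln^{\mu}(1+x)\,g(x)$ with $\delta\in\mathbb R$ and $\min\{\beta+\delta,\beta+2\delta\}>-1$, then $$\|f-\mathcal P_N^{f,Ja}\|_{L^2_\omega[-1,1]}=O\big(N^{-\beta-2\delta-1}\ln^{\mu}(N)\big).$$ In particular, if $\mu\ge1$ and $\gamma$ (respectively $\delta$) is an integer, then in case (i) (respectively case (iii)) the factor $\ln^{\mu}(N)$ may be replaced by $\ln^{\mu-1}(N)$.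
   Context: For $\alpha,\beta>-1$, $\omega(x)=(1-x)^\alpha(1+x)^\beta$ and $\|u\|_{L^2_\omega[-1,1]}=\big(\int_{-1}^1\omega(x)u(x)^2dx\big)^{1/2}$. $P_n^{(\alpha,\beta)}$ is the Jacobi polynomial of degree $n$ (standard normalization), $\sigma_n^{\alpha,\beta}=\int_{-1}^1\omega(x)[P_n^{(\alpha,\beta)}(x)]^2\,dx$, and $a_n(\alpha,\beta)=\frac{1}{\sigma_n^{\alpha,\beta}}\int_{-1}^{1}\omega(x)f(x)P_n^{(\alpha,\beta)}(x)\,dx$. The Jacobi orthogonal projection is $\mathcal P_N^{f,Ja}(x)=\sum_{n=0}^N a_n(\alpha,\beta)P_n^{(\alpha,\beta)}(x)$. The constants in the $O$-terms may depend on everything except $N$.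
   Formalization: In the "In particular" clause, γ (resp. δ) is a non-negative integer: for negative integers it fails, e.g. α=2, β=0, γ=−1, μ=1, g=1, where the error is of exact order N^{-1} ln N instead of O(N^{-1}). *)

theory Defs
  imports "HOL-Analysis.Analysis" "HOL-Library.Landau_Symbols"
begin

text \<open>
  Real-valued functions of class \<open>C\<^sup>\<infinity>\<close> on a set \<open>S\<close> without isolated points (below always the
  compact interval from \<open>-1\<close> to \<open>1\<close>): \<open>D k\<close> is the \<open>k\<close>-th derivative on \<open>S\<close>. Derivatives are taken
  within \<open>S\<close>, hence one-sided at the end points of an interval; values of \<open>g\<close> outside \<open>S\<close> are
  irrelevant. Continuity of every \<open>D k\<close> on \<open>S\<close> is implied.
\<close>

definition C_infinity_on :: "(real \<Rightarrow> real) \<Rightarrow> real set \<Rightarrow> bool" where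
  "C_infinity_on g S \<longleftrightarrow>
     (\<exists>D :: nat \<Rightarrow> real \<Rightarrow> real.
        (\<forall>x\<in>S. D 0 x = g x) \<and>
        (\<forall>k. \<forall>x\<in>S. (D k has_real_derivative D (Suc k) x) (at x within S)))"

text \<open>
  At \<open>x = 1\<close> and \<open>x = -1\<close> the convention \<open>0 powr a = 0\<close> differs from the usual one when \<open>a = 0\<close>; since
  the weight only occurs under an integral over the interval, this is immaterial.
\<close>

definition jacobi_weight :: "real \<Rightarrow> real \<Rightarrow> real \<Rightarrow> real" where
  "jacobi_weight \<alpha> \<beta> x = (1 - x) powr \<alpha> * (1 + x) powr \<beta>"

definition weighted_L2_norm :: "(real \<Rightarrow> real) \<Rightarrow> (real \<Rightarrow> real) \<Rightarrow> real" where
  "weighted_L2_norm w u = sqrt (LINT x:{-1..1}|lborel. w x * (u x)\<^sup>2)"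

text \<open>
  Jacobi polynomials by the classical explicit formula (Szego, \<open>Orthogonal Polynomials\<close>, (4.3.2);
  DLMF 18.5.8), which is meaningful for all real parameters and yields the standard normalization
  \<open>P n 1 = (n + \<alpha> choose n)\<close>.
\<close>

definition jacobi_poly :: "real \<Rightarrow> real \<Rightarrow> nat \<Rightarrow> real \<Rightarrow> real" where
  "jacobi_poly \<alpha> \<beta> n x =
     (\<Sum>k\<le>n. ((real n + \<alpha>) gchoose (n - k)) * ((real n + \<beta>) gchoose k)
             * ((x - 1) / 2) ^ k * ((x + 1) / 2) ^ (n - k))"

lemma jacobi_poly_at_1: "jacobi_poly \<alpha> \<beta> n 1 = (real n + \<alpha>) gchoose n"
proof -
  have "jacobi_poly \<alpha> \<beta> n 1 = (\<Sum>k\<le>n. if k = 0 then (real n + \<alpha>) gchoose n else 0)"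
    unfolding jacobi_poly_def by (intro sum.cong) auto
  then show ?thesis by simp
qed

definition jacobi_sigma :: "real \<Rightarrow> real \<Rightarrow> nat \<Rightarrow> real" where
  "jacobi_sigma \<alpha> \<beta> n =
     (LINT x:{-1..1}|lborel. jacobi_weight \<alpha> \<beta> x * (jacobi_poly \<alpha> \<beta> n x)\<^sup>2)"

definition jacobi_coeff :: "real \<Rightarrow> real \<Rightarrow> (real \<Rightarrow> real) \<Rightarrow> nat \<Rightarrow> real" where
  "jacobi_coeff \<alpha> \<beta> f n =
     1 / jacobi_sigma \<alpha> \<beta> n *
     (LINT x:{-1..1}|lborel. jacobi_weight \<alpha> \<beta> x * f x * jacobi_poly \<alpha> \<beta> n x)"

definition jacobi_proj :: "real \<Rightarrow> real \<Rightarrow> (real \<Rightarrow> real) \<Rightarrow> nat \<Rightarrow> real \<Rightarrow> real" where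
  "jacobi_proj \<alpha> \<beta> f N x = (\<Sum>n\<le>N. jacobi_coeff \<alpha> \<beta> f n * jacobi_poly \<alpha> \<beta> n x)"

definition jacobi_proj_error :: "real \<Rightarrow> real \<Rightarrow> (real \<Rightarrow> real) \<Rightarrow> nat \<Rightarrow> real" where
  "jacobi_proj_error \<alpha> \<beta> f N =
     weighted_L2_norm (jacobi_weight \<alpha> \<beta>) (\<lambda>x. f x - jacobi_proj \<alpha> \<beta> f N x)"

end

(*
  The error of the projection onto polynomials of degree at most N is the distance to them in the
  weighted L^2 space.  The Jacobi polynomials satisfy
    (w^(a+1,b+1) P_(n-1)^(a+1,b+1))' = -2n w^(a,b) P_n^(a,b),
  so integration by parts turns the coefficients of u for (a,b) into those of u' for (a+1,b+1), and
  Parseval's identity gives err^(a,b)_(N+1)(u) <= err^(a+1,b+1)_N(u') / (N+1)^2 for the squared errors.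

  Write y for the distance to the singularity on one side of it, and choose a scale e, namely N^-2 at
  an end point of the interval and N^-1 inside.  By ln y = ln (y/e) + ln e it suffices to treat
  (y/e)^a ln^j (y/e) g.  Multiplied by the cutoff exp(-(y/e)^-m) this function is smooth, and r steps of
  the derivative estimate bound its error; what the cutoff removes is small in norm.  Both parts
  contribute the square root of e^(rho+1), where w is at most a multiple of y^rho near the singularity.
  If a is a natural number, the only term with the full power of ln e is smooth, which saves one
  logarithm.
*)
theory Submission
  imports Defs
begin

section \<open>Orthogonal expansions in \<open>L\<^sup>2\<close>\<close>

text \<open>No asymptotics of single coefficients is used; projection errors are only compared with
  errors of simpler functions. The obstacle is that the derivative estimate wants a derivative
  continuous up to the end points, which the singular function lacks in general. A compactly
  supported cutoff would repair this, but its derivatives leave every explicit class of functions.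
  Products of powers, logarithms and exp(-t^-m) are closed under differentiation, so one induction
  over the number r of derivatives handles them all, with constants independent of the scale. The
  exponent m is a parameter because 1 - exp(-t^-m) decays only like t^-m, and the removed part has
  to be square integrable at infinity in the scaled variable t = y/e. Logarithms of t are paid for
  by a spare power of t and cost only a constant; hence the powers of ln N come from ln e
  alone.\<close>

definition square_integrable :: "'a measure \<Rightarrow> ('a \<Rightarrow> real) \<Rightarrow> bool" where
  "square_integrable M u \<longleftrightarrow> u \<in> borel_measurable M \<and> integrable M (\<lambda>x. (u x)\<^sup>2)"

lemma square_integrable_measurable: "square_integrable M u \<Longrightarrow> u \<in> borel_measurable M"
  by (simp add: square_integrable_def)

lemma square_integrable_mult:
  assumes "square_integrable M u" "square_integrable M v"
  shows "integrable M (\<lambda>x. u x * v x)"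
proof (rule Bochner_Integration.integrable_bound)
  show "integrable M (\<lambda>x. (u x)\<^sup>2 + (v x)\<^sup>2)"
    using assms by (simp add: square_integrable_def)
  show "(\<lambda>x. u x * v x) \<in> borel_measurable M"
    using assms by (auto simp: square_integrable_def)
  have "\<bar>a * b\<bar> \<le> a\<^sup>2 + b\<^sup>2" for a b :: real
    using sum_squares_bound[of "\<bar>a\<bar>" "\<bar>b\<bar>"] abs_ge_zero[of "a * b"] by (simp only: abs_mult power2_abs)
  then show "AE x in M. norm (u x * v x) \<le> norm ((u x)\<^sup>2 + (v x)\<^sup>2)"
    by (intro AE_I2) (auto intro: order_trans[OF _ abs_ge_self])
qed

lemma square_integrable_add:
  assumes "square_integrable M u" "square_integrable M v"
  shows "square_integrable M (\<lambda>x. u x + v x)"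
  using assms square_integrable_mult[OF assms]
  by (auto simp: square_integrable_def power2_sum mult.assoc)

lemma square_integrable_cmult:
  "square_integrable M u \<Longrightarrow> square_integrable M (\<lambda>x. c * u x)"
  by (auto simp: square_integrable_def power_mult_distrib)

lemma square_integrable_sum:
  "(\<And>i. i \<in> A \<Longrightarrow> square_integrable M (u i)) \<Longrightarrow> square_integrable M (\<lambda>x. \<Sum>i\<in>A. u i x)"
proof (induction A rule: infinite_finite_induct)
  case (insert i A)
  then show ?case by (simp add: square_integrable_add)
qed (auto simp: square_integrable_def)

lemma square_integrable_diff:
  assumes "square_integrable M u" "square_integrable M v"
  shows "square_integrable M (\<lambda>x. u x - v x)"
  using square_integrable_add[OF assms(1) square_integrable_cmult[OF assms(2), of "-1"]] by simp

text \<open>Completeness is brought in later, by Weierstrass' theorem in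
  \<open>jacobi_err_continuous_tendsto_0\<close>.\<close>

locale orthogonal_system =
  fixes M :: "'a measure" and P :: "nat \<Rightarrow> 'a \<Rightarrow> real"
  assumes square_integrable_P: "square_integrable M (P n)"
    and orthogonal: "m \<noteq> n \<Longrightarrow> (\<integral>x. P m x * P n x \<partial>M) = 0"
    and nondegenerate: "(\<integral>x. (P n x)\<^sup>2 \<partial>M) > 0"
begin

definition coeff :: "('a \<Rightarrow> real) \<Rightarrow> nat \<Rightarrow> real" where
  "coeff u n = (\<integral>x. u x * P n x \<partial>M) / (\<integral>x. (P n x)\<^sup>2 \<partial>M)"

definition err :: "('a \<Rightarrow> real) \<Rightarrow> nat \<Rightarrow> real" where
  "err u N = (\<integral>x. (u x - (\<Sum>n\<le>N. coeff u n * P n x))\<^sup>2 \<partial>M)"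

lemma square_integrable_combination: "square_integrable M (\<lambda>x. \<Sum>n\<le>N. d n * P n x)"
  by (intro square_integrable_sum square_integrable_cmult square_integrable_P)

lemma integral_combination_squared:
  "(\<integral>x. (\<Sum>n\<le>N. d n * P n x)\<^sup>2 \<partial>M) = (\<Sum>n\<le>N. (d n)\<^sup>2 * (\<integral>x. (P n x)\<^sup>2 \<partial>M))"
proof -
  have "(\<integral>x. (\<Sum>n\<le>N. d n * P n x)\<^sup>2 \<partial>M) = (\<integral>x. (\<Sum>m\<le>N. \<Sum>n\<le>N. (d m * d n) * (P m x * P n x)) \<partial>M)"
    by (simp add: power2_eq_square sum_product algebra_simps)
  also have "\<dots> = (\<Sum>m\<le>N. \<Sum>n\<le>N. (d m * d n) * (\<integral>x. P m x * P n x \<partial>M))"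
    using square_integrable_mult[OF square_integrable_P square_integrable_P]
    by (subst Bochner_Integration.integral_sum; (intro Bochner_Integration.integrable_sum)?; simp)
  also have "\<dots> = (\<Sum>m\<le>N. \<Sum>n\<le>N. if n = m then (d n)\<^sup>2 * (\<integral>x. (P n x)\<^sup>2 \<partial>M) else 0)"
    by (intro sum.cong refl) (auto simp: orthogonal power2_eq_square)
  finally show ?thesis by simp
qed

text \<open>Completing the square in each \<open>d n\<close>. Taking \<open>d = coeff u\<close>
  gives Parseval's form of the error in \<open>err_eq\<close>; a general \<open>d\<close> gives its
  minimality in \<open>err_le_combination\<close>.\<close>

lemma integral_diff_combination_squared:
  assumes "square_integrable M u"
  shows "(\<integral>x. (u x - (\<Sum>n\<le>N. d n * P n x))\<^sup>2 \<partial>M) =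
    (\<integral>x. (u x)\<^sup>2 \<partial>M) + (\<Sum>n\<le>N. ((d n - coeff u n)\<^sup>2 - (coeff u n)\<^sup>2) * (\<integral>x. (P n x)\<^sup>2 \<partial>M))"
proof -
  let ?S = "\<lambda>x. \<Sum>n\<le>N. d n * P n x"
  note [simp] = square_integrable_mult[OF assms square_integrable_P]
    square_integrable_mult[OF assms square_integrable_combination]
  have [simp]: "integrable M (\<lambda>x. (?S x)\<^sup>2)" "integrable M (\<lambda>x. (u x)\<^sup>2)"
    using square_integrable_combination assms by (auto simp: square_integrable_def)
  have "(\<integral>x. (u x - ?S x)\<^sup>2 \<partial>M) = (\<integral>x. (u x)\<^sup>2 + (?S x)\<^sup>2 - 2 * (u x * ?S x) \<partial>M)"
    by (simp add: power2_diff mult.assoc)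
  also have "\<dots> = (\<integral>x. (u x)\<^sup>2 \<partial>M) + (\<integral>x. (?S x)\<^sup>2 \<partial>M) - 2 * (\<integral>x. u x * ?S x \<partial>M)"
    by simp
  also have "(\<integral>x. u x * ?S x \<partial>M) = (\<integral>x. (\<Sum>n\<le>N. d n * (u x * P n x)) \<partial>M)"
    by (simp add: sum_distrib_left mult_ac)
  also have "\<dots> = (\<Sum>n\<le>N. d n * (coeff u n * (\<integral>x. (P n x)\<^sup>2 \<partial>M)))"
    using nondegenerate by (simp add: coeff_def less_imp_neq[symmetric])
  finally show ?thesis
    unfolding integral_combination_squared
    by (simp add: power2_diff sum.distrib sum_distrib_left algebra_simps sum_subtractf)
qed

lemma err_eq:
  assumes "square_integrable M u"
  shows "err u N = (\<integral>x. (u x)\<^sup>2 \<partial>M) - (\<Sum>n\<le>N. (coeff u n)\<^sup>2 * (\<integral>x. (P n x)\<^sup>2 \<partial>M))"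
  unfolding err_def integral_diff_combination_squared[OF assms] by (simp add: sum_negf)

lemma err_le_combination:
  assumes "square_integrable M u"
  shows "err u N \<le> (\<integral>x. (u x - (\<Sum>n\<le>N. d n * P n x))\<^sup>2 \<partial>M)"
  unfolding err_eq[OF assms] integral_diff_combination_squared[OF assms]
  by (auto simp: left_diff_distrib sum_subtractf
      intro!: sum_nonneg mult_nonneg_nonneg less_imp_le[OF nondegenerate])

lemma err_nonneg: "0 \<le> err u N"
  by (simp add: err_def)

lemma err_le_integral: "square_integrable M u \<Longrightarrow> err u N \<le> (\<integral>x. (u x)\<^sup>2 \<partial>M)"
  using err_le_combination[of u N "\<lambda>_. 0"] by simp

text \<open>The inequality (a + b)^2 <= 2 a^2 + 2 b^2 stands in for the triangle inequality, so that
  all estimates stay with squared errors; only orders of magnitude matter.\<close>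

lemma err_add:
  assumes u: "square_integrable M u" and v: "square_integrable M v"
  shows "err (\<lambda>x. u x + v x) N \<le> 2 * err u N + 2 * err v N"
proof -
  let ?d = "\<lambda>u x. u x - (\<Sum>n\<le>N. coeff u n * P n x)"
  have c: "coeff (\<lambda>x. u x + v x) n = coeff u n + coeff v n" for n
    using square_integrable_mult[OF u square_integrable_P] square_integrable_mult[OF v square_integrable_P]
    by (simp add: coeff_def add_divide_distrib distrib_right)
  have d: "square_integrable M (?d u)" "square_integrable M (?d v)"
    using u v by (intro square_integrable_diff square_integrable_combination; simp)+
  have "err (\<lambda>x. u x + v x) N = (\<integral>x. (?d u x + ?d v x)\<^sup>2 \<partial>M)"
    unfolding err_def c by (intro Bochner_Integration.integral_cong refl)
      (simp add: algebra_simps sum.distrib)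
  also have "\<dots> \<le> (\<integral>x. 2 * (?d u x)\<^sup>2 + 2 * (?d v x)\<^sup>2 \<partial>M)"
  proof (rule integral_mono)
    show "integrable M (\<lambda>x. (?d u x + ?d v x)\<^sup>2)"
      using square_integrable_add[OF d] by (simp add: square_integrable_def)
    show "integrable M (\<lambda>x. 2 * (?d u x)\<^sup>2 + 2 * (?d v x)\<^sup>2)"
      using d by (simp add: square_integrable_def)
    have "(a + b)\<^sup>2 \<le> 2 * a\<^sup>2 + 2 * b\<^sup>2" for a b :: real
      using sum_squares_bound[of a b] by (simp add: power2_sum)
    then show "(?d u x + ?d v x)\<^sup>2 \<le> 2 * (?d u x)\<^sup>2 + 2 * (?d v x)\<^sup>2" for x .
  qed
  also have "\<dots> = 2 * err u N + 2 * err v N"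
    using d by (simp add: square_integrable_def err_def)
  finally show ?thesis .
qed

lemma err_cmult: "err (\<lambda>x. c * u x) N = c\<^sup>2 * err u N"
proof -
  have c: "coeff (\<lambda>x. c * u x) n = c * coeff u n" for n
    by (simp add: coeff_def mult.assoc)
  have "err (\<lambda>x. c * u x) N = (\<integral>x. c\<^sup>2 * (u x - (\<Sum>n\<le>N. coeff u n * P n x))\<^sup>2 \<partial>M)"
    unfolding err_def c by (intro Bochner_Integration.integral_cong refl)
      (simp add: power_mult_distrib[symmetric] algebra_simps sum_distrib_left)
  then show ?thesis by (simp add: err_def)
qed

lemma err_sum:
  assumes "\<And>j. j \<le> n \<Longrightarrow> square_integrable M (u j)"
  shows "err (\<lambda>x. \<Sum>j\<le>n. u j x) N \<le> 2 ^ n * (\<Sum>j\<le>n. err (u j) N)"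
  using assms
proof (induction n)
  case (Suc n)
  have "err (\<lambda>x. \<Sum>j\<le>Suc n. u j x) N \<le> 2 * err (\<lambda>x. \<Sum>j\<le>n. u j x) N + 2 * err (u (Suc n)) N"
    unfolding sum.atMost_Suc using Suc.prems by (intro err_add square_integrable_sum) auto
  also have "\<dots> \<le> 2 * (2 ^ n * (\<Sum>j\<le>n. err (u j) N)) + 2 * (2 ^ n * err (u (Suc n)) N)"
    using Suc err_nonneg[of "u (Suc n)" N] mult_right_mono[of 1 "2 ^ n" "err (u (Suc n)) N"]
    by (intro add_mono mult_left_mono) auto
  also have "\<dots> = 2 ^ Suc n * (\<Sum>j\<le>Suc n. err (u j) N)"
    by (simp add: algebra_simps)
  finally show ?case .
qed simp

text \<open>Needed because the functions of the theorem are prescribed only off the singular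
  point.\<close>

lemma err_cong_AE:
  assumes "u \<in> borel_measurable M" "v \<in> borel_measurable M" "AE x in M. u x = v x"
  shows "err u N = err v N"
proof -
  have P [measurable]: "P n \<in> borel_measurable M" for n
    using square_integrable_P by (rule square_integrable_measurable)
  note [measurable] = assms(1,2)
  have "coeff u n = coeff v n" for n
    unfolding coeff_def using assms(3)
    by (intro arg_cong2[where f="(/)"] integral_cong_AE) auto
  then show ?thesis
    unfolding err_def using assms(3) by (intro integral_cong_AE) auto
qed

end

section \<open>Jacobi polynomials\<close>

lemma jacobi_weight_nonneg: "0 \<le> jacobi_weight \<alpha> \<beta> x"
  by (simp add: jacobi_weight_def)

lemma borel_measurable_jacobi_weight [measurable]: "jacobi_weight \<alpha> \<beta> \<in> borel_measurable borel"
  unfolding jacobi_weight_def[abs_def] by measurable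

text \<open>The substitution t = (1 + x)/2 turns the weight into a multiple of the integrand of the
  Beta function at (\<open>\<beta> + 1\<close>, \<open>\<alpha> + 1\<close>).\<close>

lemma set_integrable_jacobi_weight:
  assumes "\<alpha> > -1" "\<beta> > -1"
  shows "set_integrable lborel {-1..1} (jacobi_weight \<alpha> \<beta>)"
proof -
  let ?B = "\<lambda>t::real. indicator {0..1} t *\<^sub>R (t powr \<beta> * (1 - t) powr \<alpha>)"
  have "integrable lborel ?B"
    using integrable_Beta[of "\<beta> + 1" "\<alpha> + 1"] assms by (simp add: set_integrable_def)
  then have "integrable lborel (\<lambda>x. 2 powr (\<alpha> + \<beta>) * ?B (1/2 + 1/2 * x))"
    by (intro integrable_mult_right lborel_integrable_real_affine) auto
  moreover have "2 powr (\<alpha> + \<beta>) * ?B (1/2 + 1/2 * x) = indicator {-1..1} x *\<^sub>R jacobi_weight \<alpha> \<beta> x" for x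
  proof (cases "x \<in> {-1..1}")
    case True
    have "1/2 + 1/2 * x = (1 + x) / 2" "1 - (1 + x) / 2 = (1 - x) / 2" by (simp_all add: field_simps)
    moreover have "indicator {0..1} ((1 + x) / 2) = (1::real)" "0 \<le> 1 + x" "0 \<le> 1 - x"
      using True by (auto simp: indicator_def)
    ultimately show ?thesis
      using True by (simp only: jacobi_weight_def) (simp add: powr_divide powr_add)
  next
    case False
    then show ?thesis by (auto simp: indicator_def)
  qed
  ultimately show ?thesis by (simp only: set_integrable_def)
qed

text \<open>Restricting the space makes every function continuous on the interval measurable,
  whatever its values outside; the smooth factor \<open>g\<close> is only known to be of this
  kind.\<close>

definition jacobi_measure :: "real \<Rightarrow> real \<Rightarrow> real measure" where
  "jacobi_measure \<alpha> \<beta> = density (restrict_space lborel {-1..1}) (jacobi_weight \<alpha> \<beta>)"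

lemma space_jacobi_measure [simp]: "space (jacobi_measure \<alpha> \<beta>) = {-1..1}"
  by (simp add: jacobi_measure_def space_restrict_space)

lemma borel_measurable_jacobi_measure:
  "borel_measurable (jacobi_measure \<alpha> \<beta>) = borel_measurable (restrict_space borel {-1..1})"
  by (intro measurable_cong_sets refl)
    (simp add: jacobi_measure_def sets_restrict_space_cong[OF sets_lborel])

lemma borel_measurable_jacobi_measure_borel [measurable (raw)]:
  "u \<in> borel_measurable borel \<Longrightarrow> u \<in> borel_measurable (jacobi_measure \<alpha> \<beta>)"
  unfolding borel_measurable_jacobi_measure by (rule measurable_restrict_space1)

lemma borel_measurable_jacobi_measure_continuous:
  "continuous_on {-1..1} u \<Longrightarrow> u \<in> borel_measurable (jacobi_measure \<alpha> \<beta>)"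
  unfolding borel_measurable_jacobi_measure by (rule borel_measurable_continuous_on_restrict)

lemma
  fixes u :: "real \<Rightarrow> real"
  assumes "u \<in> borel_measurable (jacobi_measure \<alpha> \<beta>)"
  shows integrable_jacobi_measure:
      "integrable (jacobi_measure \<alpha> \<beta>) u \<longleftrightarrow>
        set_integrable lborel {-1..1} (\<lambda>x. jacobi_weight \<alpha> \<beta> x * u x)"
    and integral_jacobi_measure:
      "(\<integral>x. u x \<partial>jacobi_measure \<alpha> \<beta>) = (LINT x:{-1..1}|lborel. jacobi_weight \<alpha> \<beta> x * u x)"
proof -
  have [measurable]: "u \<in> borel_measurable (restrict_space lborel {-1..1})"
    using assms unfolding borel_measurable_jacobi_measure
    by (simp add: measurable_cong_sets[OF sets_restrict_space_cong[OF sets_lborel] refl])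
  have [measurable]: "jacobi_weight \<alpha> \<beta> \<in> borel_measurable (restrict_space lborel {-1..1})"
    by (rule measurable_restrict_space1) simp
  show "integrable (jacobi_measure \<alpha> \<beta>) u \<longleftrightarrow>
      set_integrable lborel {-1..1} (\<lambda>x. jacobi_weight \<alpha> \<beta> x * u x)"
    unfolding jacobi_measure_def set_integrable_def
    by (subst integrable_density) (auto simp: jacobi_weight_nonneg integrable_restrict_space)
  show "(\<integral>x. u x \<partial>jacobi_measure \<alpha> \<beta>) = (LINT x:{-1..1}|lborel. jacobi_weight \<alpha> \<beta> x * u x)"
    unfolding jacobi_measure_def set_lebesgue_integral_def
    by (subst integral_density) (auto simp: jacobi_weight_nonneg integral_restrict_space)
qed

lemma jacobi_sigma_eq: "jacobi_sigma \<alpha> \<beta> n = (\<integral>x. (jacobi_poly \<alpha> \<beta> n x)\<^sup>2 \<partial>jacobi_measure \<alpha> \<beta>)"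
proof -
  have "jacobi_poly \<alpha> \<beta> n \<in> borel_measurable borel"
    unfolding jacobi_poly_def[abs_def] by measurable
  then show ?thesis
    unfolding jacobi_sigma_def by (subst integral_jacobi_measure) auto
qed

lemma integrable_jacobi_measure_bounded:
  fixes u :: "real \<Rightarrow> real"
  assumes "\<alpha> > -1" "\<beta> > -1" "u \<in> borel_measurable (jacobi_measure \<alpha> \<beta>)"
    and "\<And>x. x \<in> {-1..1} \<Longrightarrow> \<bar>u x\<bar> \<le> B"
  shows "integrable (jacobi_measure \<alpha> \<beta>) u"
proof (rule Bochner_Integration.integrable_bound)
  show "integrable (jacobi_measure \<alpha> \<beta>) (\<lambda>_. B)"
    using set_integrable_jacobi_weight[OF assms(1,2)]
    by (subst integrable_jacobi_measure) (auto intro: set_integrable_mult_left)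
  show "AE x in jacobi_measure \<alpha> \<beta>. norm (u x) \<le> norm B"
    using assms(4) by (intro AE_I2) (fastforce intro: order_trans[OF _ abs_ge_self])
qed fact

lemma square_integrable_jacobi_bounded:
  fixes u :: "real \<Rightarrow> real"
  assumes "\<alpha> > -1" "\<beta> > -1" "u \<in> borel_measurable (jacobi_measure \<alpha> \<beta>)"
    and "\<And>x. x \<in> {-1..1} \<Longrightarrow> \<bar>u x\<bar> \<le> B"
  shows "square_integrable (jacobi_measure \<alpha> \<beta>) u"
  unfolding square_integrable_def
proof (intro conjI assms(3) integrable_jacobi_measure_bounded[where B="B\<^sup>2"] assms(1,2))
  show "(\<lambda>x. (u x)\<^sup>2) \<in> borel_measurable (jacobi_measure \<alpha> \<beta>)" using assms(3) by measurable
  show "\<bar>(u x)\<^sup>2\<bar> \<le> B\<^sup>2" if "x \<in> {-1..1}" for x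
    using power_mono[OF assms(4)[OF that], of 2] by simp
qed

lemma square_integrable_jacobi_continuous:
  fixes u :: "real \<Rightarrow> real"
  assumes "\<alpha> > -1" "\<beta> > -1" "continuous_on {-1..1} u"
  shows "square_integrable (jacobi_measure \<alpha> \<beta>) u"
proof -
  have "bounded (u ` {-1..1})"
    using assms(3) by (intro compact_imp_bounded compact_continuous_image) auto
  then obtain B where "\<forall>x\<in>{-1..1}. \<bar>u x\<bar> \<le> B"
    unfolding bounded_iff by auto
  then show ?thesis
    using assms by (intro square_integrable_jacobi_bounded[where B=B] borel_measurable_jacobi_measure_continuous) blast+
qed

lemma integral_jacobi_weight_pos:
  assumes "\<alpha> > -1" "\<beta> > -1"
  shows "(LINT x:{-1..1}|lborel. jacobi_weight \<alpha> \<beta> x) > 0"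
proof -
  have "(LINT x:{-1..1}|lborel. jacobi_weight \<alpha> \<beta> x) \<noteq> 0"
  proof
    assume "(LINT x:{-1..1}|lborel. jacobi_weight \<alpha> \<beta> x) = 0"
    then have "AE x in lborel. indicator {-1..1} x *\<^sub>R jacobi_weight \<alpha> \<beta> x = 0"
      using set_integrable_jacobi_weight[OF assms]
      unfolding set_lebesgue_integral_def set_integrable_def
      by (subst (asm) integral_nonneg_eq_0_iff_AE) (auto simp: jacobi_weight_nonneg)
    \<comment> \<open>The weight is positive on the open interval, so its vanishing almost
      everywhere would make that interval a null set.\<close>
    then have "AE x in lborel. x \<notin> {-1<..<1::real}"
      by eventually_elim (auto simp: jacobi_weight_def indicator_def)
    then have "emeasure lborel {-1<..<1::real} = 0"
      by (subst (asm) AE_iff_measurable[of "{-1<..<1::real}"]) auto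
    then show False by simp
  qed
  moreover have "(LINT x:{-1..1}|lborel. jacobi_weight \<alpha> \<beta> x) \<ge> 0"
    unfolding set_lebesgue_integral_def by (intro integral_nonneg_AE) (auto simp: jacobi_weight_nonneg)
  ultimately show ?thesis by simp
qed

section \<open>Algebra and orthogonality of the Jacobi polynomials\<close>

definition jacobi_polynomial :: "real \<Rightarrow> real \<Rightarrow> nat \<Rightarrow> real poly" where
  "jacobi_polynomial \<alpha> \<beta> n =
     (\<Sum>k\<le>n. smult (((real n + \<alpha>) gchoose (n - k)) * ((real n + \<beta>) gchoose k))
       ([:- (1/2), 1/2:] ^ k * [:1/2, 1/2:] ^ (n - k)))"

lemma poly_jacobi_polynomial: "poly (jacobi_polynomial \<alpha> \<beta> n) x = jacobi_poly \<alpha> \<beta> n x"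
proof -
  have "((x - 1) / 2) ^ k = (x / 2 - 1 / 2) ^ k" "((x + 1) / 2) ^ k = (1 / 2 + x / 2) ^ k" for k
    by (simp_all add: diff_divide_distrib add_divide_distrib add.commute)
  then show ?thesis
    unfolding jacobi_polynomial_def jacobi_poly_def by (simp only: poly_sum) (simp add: mult_ac)
qed

lemma degree_linear_power_mult:
  "k \<le> n \<Longrightarrow> degree ([:- (1/2), 1/2::real:] ^ k * [:1/2, 1/2:] ^ (n - k)) = n"
  by (subst degree_mult_eq) (auto simp: degree_power_eq)

lemma degree_jacobi_polynomial: "degree (jacobi_polynomial \<alpha> \<beta> n) \<le> n"
  unfolding jacobi_polynomial_def
  by (intro degree_sum_le)
    (use degree_linear_power_mult in \<open>auto intro!: order_trans[OF degree_smult_le] simp del: One_nat_def\<close>)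

text \<open>Every product of linear factors has leading coefficient 2^-n, so Vandermonde's
  convolution sums the binomials.\<close>

lemma coeff_jacobi_polynomial:
  "coeff (jacobi_polynomial \<alpha> \<beta> n) n = ((2 * real n + \<alpha> + \<beta>) gchoose n) / 2 ^ n"
proof -
  have lc: "coeff ([:- (1/2), 1/2::real:] ^ k * [:1/2, 1/2:] ^ (n - k)) n = 1 / 2 ^ n" if "k \<le> n" for k
  proof -
    have "coeff ([:- (1/2), 1/2::real:] ^ k * [:1/2, 1/2:] ^ (n - k)) n =
        lead_coeff ([:- (1/2), 1/2::real:] ^ k * [:1/2, 1/2:] ^ (n - k))"
      by (simp only: degree_linear_power_mult[OF that])
    also have "\<dots> = (1/2) ^ k * (1/2) ^ (n - k)"
      unfolding lead_coeff_mult lead_coeff_power by simp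
    finally show ?thesis using that by (simp add: power_add[symmetric] power_one_over)
  qed
  have "coeff (jacobi_polynomial \<alpha> \<beta> n) n =
      (\<Sum>k\<le>n. ((real n + \<beta>) gchoose k) * ((real n + \<alpha>) gchoose (n - k)) * (1 / 2 ^ n))"
    unfolding jacobi_polynomial_def coeff_sum by (intro sum.cong refl) (simp add: lc del: degree_mult_eq)
  also have "\<dots> = ((real n + \<beta> + (real n + \<alpha>)) gchoose n) / 2 ^ n"
    using gbinomial_Vandermonde[of "real n + \<beta>" "real n + \<alpha>" n]
    by (simp only: atLeast0AtMost sum_distrib_right[symmetric]) simp
  finally show ?thesis by (simp add: algebra_simps)
qed

lemma continuous_on_jacobi_poly [continuous_intros]: "continuous_on A (jacobi_poly \<alpha> \<beta> n)"
  unfolding poly_jacobi_polynomial[symmetric, abs_def] by (intro continuous_intros)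

text \<open>Absorbing the linear factors into the weight leaves a sum of pure powers, which can be
  differentiated term by term. The end points are left out because the powers are merged by laws for
  a positive base.\<close>

lemma jacobi_weight_mult_poly:
  assumes "x \<in> {-1<..<1}"
  shows "jacobi_weight \<alpha> \<beta> x * jacobi_poly \<alpha> \<beta> n x =
    (\<Sum>k\<le>n. (-1) ^ k / 2 ^ n * ((real n + \<alpha>) gchoose (n - k)) * ((real n + \<beta>) gchoose k) *
       ((1 - x) powr (\<alpha> + k) * (1 + x) powr (\<beta> + (n - k))))"
  unfolding jacobi_weight_def jacobi_poly_def sum_distrib_left
proof (intro sum.cong refl)
  fix k assume "k \<in> {..n}"
  then have n: "(2::real) ^ n = 2 ^ k * 2 ^ (n - k)" by (simp add: power_add[symmetric])
  have "(x - 1) ^ k = (-1) ^ k * (1 - x) ^ k"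
    by (simp add: power_mult_distrib[symmetric])
  then show "(1 - x) powr \<alpha> * (1 + x) powr \<beta> *
      (((real n + \<alpha>) gchoose (n - k)) * ((real n + \<beta>) gchoose k) * ((x - 1) / 2) ^ k * ((x + 1) / 2) ^ (n - k)) =
    (-1) ^ k / 2 ^ n * ((real n + \<alpha>) gchoose (n - k)) * ((real n + \<beta>) gchoose k) *
       ((1 - x) powr (\<alpha> + k) * (1 + x) powr (\<beta> + (n - k)))"
    using assms unfolding n by (simp add: powr_add powr_realpow power_divide add.commute)
qed

lemma gbinomial_Suc_mult: "((a::real) gchoose Suc k) * (1 + real k) = (a gchoose k) * (a - real k)"
  using gbinomial_mult_1[of a k] by (simp add: algebra_simps)

text \<open>The derivative of the \<open>k\<close>-th power product meets only \<open>?T k\<close>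
  and \<open>?T (Suc k)\<close>. After collecting, \<open>?T k\<close> receives \<open>d k\<close>
  with the factors \<open>?N - k\<close> and \<open>k\<close>, whose sum is
  \<open>?N\<close>.\<close>

lemma jacobi_weight_mult_poly_derivative:
  assumes x: "x \<in> {-1<..<1}"
  shows "((\<lambda>x. jacobi_weight (\<alpha> + 1) (\<beta> + 1) x * jacobi_poly (\<alpha> + 1) (\<beta> + 1) n x) has_real_derivative
    - 2 * real (Suc n) * (jacobi_weight \<alpha> \<beta> x * jacobi_poly \<alpha> \<beta> (Suc n) x)) (at x)"
proof -
  let ?N = "Suc n"
  let ?T = "\<lambda>k. (1 - x) powr (\<alpha> + real k) * (1 + x) powr (\<beta> + real (?N - k))"
  define d where "d k = (-1) ^ k / 2 ^ ?N * ((real ?N + \<alpha>) gchoose (?N - k)) * ((real ?N + \<beta>) gchoose k)" for k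
  define c where "c k = (-1) ^ k / 2 ^ n * ((real n + (\<alpha> + 1)) gchoose (n - k)) * ((real n + (\<beta> + 1)) gchoose k)" for k
  let ?D = "\<lambda>k. - (\<alpha> + 1 + real k) * ?T k + (\<beta> + 1 + real (n - k)) * ?T (Suc k)"
  have "((\<lambda>x. \<Sum>k\<le>n. c k * ((1 - x) powr (\<alpha> + 1 + real k) * (1 + x) powr (\<beta> + 1 + real (n - k))))
      has_real_derivative (\<Sum>k\<le>n. c k * ?D k)) (at x)"
  proof (intro DERIV_sum DERIV_cmult)
    fix k assume "k \<in> {..n}"
    then have e: "real (Suc n - k) = 1 + real (n - k)" by (auto simp: of_nat_diff)
    show "((\<lambda>x. (1 - x) powr (\<alpha> + 1 + real k) * (1 + x) powr (\<beta> + 1 + real (n - k))) has_real_derivative ?D k) (at x)"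
    proof (rule DERIV_cong[OF DERIV_mult])
      show "((\<lambda>x. (1 - x) powr (\<alpha> + 1 + real k)) has_real_derivative
          - (\<alpha> + 1 + real k) * (1 - x) powr (\<alpha> + real k)) (at x)"
        using x by (intro DERIV_cong[OF DERIV_chain2[OF has_real_derivative_powr]]
            derivative_eq_intros refl) (auto intro!: arg_cong[where f="(powr) _"])
      show "((\<lambda>x. (1 + x) powr (\<beta> + 1 + real (n - k))) has_real_derivative
          (\<beta> + 1 + real (n - k)) * (1 + x) powr (\<beta> + real (n - k))) (at x)"
        using x by (intro DERIV_cong[OF DERIV_chain2[OF has_real_derivative_powr]]
            derivative_eq_intros refl) (auto intro!: arg_cong[where f="(powr) _"])
    qed (simp add: e algebra_simps)
  qed
  moreover have "(\<Sum>k\<le>n. c k * ?D k) = - 2 * real ?N * (\<Sum>k\<le>?N. d k * ?T k)"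
  proof -
    \<comment> \<open>Here and in \<open>c2\<close> the exponent brought down by differentiation is
      absorbed by a binomial coefficient, which raises its lower index by one and leaves an index
      factor.\<close>
    have c1: "c k * (\<alpha> + 1 + real k) = 2 * (real (?N - k) * d k)" if "k \<le> n" for k
    proof -
      define A where "A = ((real ?N + \<alpha>) gchoose (n - k))"
      define A' where "A' = ((real ?N + \<alpha>) gchoose Suc (n - k))"
      define e where "e = (-1) ^ k / 2 ^ n * ((real ?N + \<beta>) gchoose k)"
      have "c k = e * A" "2 * d k = e * A'"
        using that by (simp_all add: c_def d_def A_def A'_def e_def Suc_diff_le algebra_simps)
      moreover have "A' * real (?N - k) = A * (\<alpha> + 1 + real k)"
        using that gbinomial_Suc_mult[of "real ?N + \<alpha>" "n - k"]
        by (simp add: A_def A'_def of_nat_diff algebra_simps)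
      ultimately show ?thesis by (metis mult.assoc mult.commute)
    qed
    have c2: "c k * (\<beta> + 1 + real (n - k)) = - 2 * (real (Suc k) * d (Suc k))" if "k \<le> n" for k
    proof -
      define A where "A = ((real ?N + \<beta>) gchoose k)"
      define A' where "A' = ((real ?N + \<beta>) gchoose Suc k)"
      define e where "e = (-1) ^ k / 2 ^ n * ((real ?N + \<alpha>) gchoose (n - k))"
      have "c k = e * A" "- 2 * d (Suc k) = e * A'"
        using that by (simp_all add: c_def d_def A_def A'_def e_def algebra_simps)
      moreover have "A' * real (Suc k) = A * (\<beta> + 1 + real (n - k))"
        using that gbinomial_Suc_mult[of "real ?N + \<beta>" k]
        by (simp add: A_def A'_def of_nat_diff algebra_simps)
      ultimately show ?thesis by (metis mult.assoc mult.commute)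
    qed
    have gen: "z * (- a * t + b * s) = - (z * a) * t + (z * b) * s" for z a t b s :: real
      by (simp add: algebra_simps)
    have "c k * ?D k = - (c k * (\<alpha> + 1 + real k)) * ?T k + (c k * (\<beta> + 1 + real (n - k))) * ?T (Suc k)" for k
      by (rule gen)
    then have "(\<Sum>k\<le>n. c k * ?D k) =
        (\<Sum>k\<le>n. - (2 * (real (?N - k) * d k)) * ?T k + (- 2 * (real (Suc k) * d (Suc k))) * ?T (Suc k))"
      by (intro sum.cong refl) (simp only: c1 c2 atMost_iff)
    also have "\<dots> = - 2 * ((\<Sum>k\<le>n. real (?N - k) * d k * ?T k) + (\<Sum>k\<le>n. real (Suc k) * d (Suc k) * ?T (Suc k)))"
      unfolding sum.distrib[symmetric] sum_distrib_left
      by (intro sum.cong refl) (simp only: distrib_left mult_minus_left mult.assoc)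
    \<comment> \<open>Both sums may run over all indices up to \<open>?N\<close>: here the added
      last term has the factor \<open>?N - ?N\<close>, and after the shift below the added first
      term has the factor \<open>0\<close>.\<close>
    also have "(\<Sum>k\<le>n. real (?N - k) * d k * ?T k) = (\<Sum>k\<le>?N. real (?N - k) * d k * ?T k)"
      by simp
    also have "(\<Sum>k\<le>n. real (Suc k) * d (Suc k) * ?T (Suc k)) = (\<Sum>k\<le>?N. real k * d k * ?T k)"
      by (subst sum.atMost_Suc_shift) simp
    also have "(\<Sum>k\<le>?N. real (?N - k) * d k * ?T k) + (\<Sum>k\<le>?N. real k * d k * ?T k) =
        (\<Sum>k\<le>?N. real ?N * (d k * ?T k))"
      unfolding sum.distrib[symmetric]
      by (intro sum.cong refl) (simp only: atMost_iff of_nat_diff algebra_simps)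
    finally show ?thesis by (simp only: sum_distrib_left[symmetric] mult.assoc)
  qed
  moreover have "(\<Sum>k\<le>?N. d k * ?T k) = jacobi_weight \<alpha> \<beta> x * jacobi_poly \<alpha> \<beta> ?N x"
    unfolding d_def by (rule jacobi_weight_mult_poly[OF x, symmetric])
  ultimately have "((\<lambda>x. \<Sum>k\<le>n. c k * ((1 - x) powr (\<alpha> + 1 + real k) * (1 + x) powr (\<beta> + 1 + real (n - k))))
      has_real_derivative - 2 * real ?N * (jacobi_weight \<alpha> \<beta> x * jacobi_poly \<alpha> \<beta> ?N x)) (at x)"
    by (simp only:)
  then show ?thesis
  proof (rule DERIV_cong_ev[THEN iffD1, rotated 3, OF _ refl _ refl])
    show "\<forall>\<^sub>F x in nhds x. (\<Sum>k\<le>n. c k * ((1 - x) powr (\<alpha> + 1 + real k) * (1 + x) powr (\<beta> + 1 + real (n - k)))) =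
        jacobi_weight (\<alpha> + 1) (\<beta> + 1) x * jacobi_poly (\<alpha> + 1) (\<beta> + 1) n x"
      unfolding c_def using x
      by (intro eventually_mono[OF eventually_nhds_in_open[of "{-1<..<1}"]])
        (auto simp: jacobi_weight_mult_poly)
  qed
qed

lemma continuous_on_jacobi_weight:
  "0 < \<alpha> \<Longrightarrow> 0 < \<beta> \<Longrightarrow> continuous_on {-1..1} (jacobi_weight \<alpha> \<beta>)"
  unfolding jacobi_weight_def[abs_def] by (intro continuous_intros continuous_on_powr') auto

text \<open>The primitive \<open>?G\<close> carries the weight with the raised, hence positive,
  exponents: it is continuous up to the end points and vanishes there. So there are no boundary
  terms, although the integrand \<open>?A\<close> may be unbounded, and the derivative of
  \<open>u\<close> is needed in the interior only.\<close>

lemma jacobi_integration_by_parts: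
  assumes ab: "\<alpha> > -1" "\<beta> > -1"
    and u: "continuous_on {-1..1} u" and u': "continuous_on {-1..1} u'"
    and deriv: "\<And>x. x \<in> {-1<..<1} \<Longrightarrow> (u has_real_derivative u' x) (at x)"
  shows "(\<integral>x. u x * jacobi_poly \<alpha> \<beta> (Suc n) x \<partial>jacobi_measure \<alpha> \<beta>) =
    (\<integral>x. u' x * jacobi_poly (\<alpha> + 1) (\<beta> + 1) n x \<partial>jacobi_measure (\<alpha> + 1) (\<beta> + 1)) / (2 * real (Suc n))"
proof -
  let ?w = "jacobi_weight \<alpha> \<beta>" and ?w' = "jacobi_weight (\<alpha> + 1) (\<beta> + 1)"
  let ?P = "jacobi_poly \<alpha> \<beta> (Suc n)" and ?Q = "jacobi_poly (\<alpha> + 1) (\<beta> + 1) n"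
  let ?A = "\<lambda>x. ?w x * (u x * ?P x)" and ?B = "\<lambda>x. ?w' x * (u' x * ?Q x)"
  have int: "set_integrable lborel {-1..1} (\<lambda>x. jacobi_weight a b x * (v x * jacobi_poly a b m x))"
    if "a > -1" "b > -1" "continuous_on {-1..1} v" for a b v m
    using that square_integrable_mult[OF square_integrable_jacobi_continuous[OF that]
        square_integrable_jacobi_continuous[OF that(1,2) continuous_on_jacobi_poly]]
    by (subst (asm) integrable_jacobi_measure)
      (auto intro!: borel_measurable_jacobi_measure_continuous continuous_intros)
  have A: "set_integrable lborel {-1..1} ?A" and B: "set_integrable lborel {-1..1} ?B"
    using int ab u u' by auto
  let ?H = "\<lambda>x. ?B x - 2 * real (Suc n) * ?A x"
  let ?G = "\<lambda>x. (?w' x * ?Q x) * u x"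
  have H: "set_integrable lborel {-1..1} ?H"
    using A B by (intro set_integral_diff) auto
  have "(?H has_integral (?G 1 - ?G (-1))) {-1..1}"
  proof (rule fundamental_theorem_of_calculus_interior)
    show "continuous_on {-1..1} ?G"
      using ab u by (intro continuous_intros continuous_on_jacobi_weight) auto
    show "(?G has_vector_derivative ?H x) (at x)" if "x \<in> {-1<..<1}" for x
      using DERIV_mult[OF jacobi_weight_mult_poly_derivative[OF that, of \<alpha> \<beta> n] deriv[OF that]]
      unfolding has_real_derivative_iff_has_vector_derivative[symmetric]
      by (simp add: algebra_simps)
  qed simp
  moreover have "?G 1 = 0" "?G (-1) = 0"
    by (simp_all add: jacobi_weight_def)
  ultimately have "(LINT x:{-1..1}|lborel. ?H x) = 0"
    using set_borel_integral_eq_integral(2)[OF H] by (simp add: integral_unique)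
  moreover have "(LINT x:{-1..1}|lborel. ?H x) = (LINT x:{-1..1}|lborel. ?B x) - 2 * real (Suc n) * (LINT x:{-1..1}|lborel. ?A x)"
    using A B by (subst set_integral_diff(2)) auto
  ultimately show ?thesis
    using u u' by (subst (1 2) integral_jacobi_measure)
      (auto intro!: borel_measurable_jacobi_measure_continuous continuous_intros simp: field_simps)
qed

text \<open>Each integration by parts lowers \<open>n\<close> and the degree of \<open>q\<close>
  together, while the parameters rise; \<open>q\<close> is differentiated away before
  \<open>n\<close> is used up.\<close>

lemma jacobi_orthogonal_lower_degree:
  "\<alpha> > -1 \<Longrightarrow> \<beta> > -1 \<Longrightarrow> degree q < n \<Longrightarrow>
    (\<integral>x. poly q x * jacobi_poly \<alpha> \<beta> n x \<partial>jacobi_measure \<alpha> \<beta>) = 0"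
proof (induction n arbitrary: \<alpha> \<beta> q)
  case (Suc n)
  have "(\<integral>x. poly (pderiv q) x * jacobi_poly (\<alpha> + 1) (\<beta> + 1) n x \<partial>jacobi_measure (\<alpha> + 1) (\<beta> + 1)) = 0"
  \<comment> \<open>A constant is treated apart: its derivative has degree \<open>0\<close>, which
    is not below \<open>n\<close> when \<open>n = 0\<close>.\<close>
  proof (cases "degree q = 0")
    case True
    then show ?thesis by (simp add: pderiv_eq_0_iff[THEN iffD2])
  next
    case False
    then show ?thesis using Suc by (intro Suc.IH) (auto simp: degree_pderiv)
  qed
  moreover have "(\<integral>x. poly q x * jacobi_poly \<alpha> \<beta> (Suc n) x \<partial>jacobi_measure \<alpha> \<beta>) =
      (\<integral>x. poly (pderiv q) x * jacobi_poly (\<alpha> + 1) (\<beta> + 1) n x \<partial>jacobi_measure (\<alpha> + 1) (\<beta> + 1)) / (2 * real (Suc n))"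
    using Suc.prems by (intro jacobi_integration_by_parts) (auto intro!: continuous_intros poly_DERIV)
  ultimately show ?case by simp
qed simp

lemma integral_jacobi_poly_leading:
  assumes ab: "\<alpha> > -1" "\<beta> > -1" and q: "degree q \<le> n"
    and lead: "coeff q n = c * coeff (jacobi_polynomial \<alpha> \<beta> n) n"
  shows "(\<integral>x. poly q x * jacobi_poly \<alpha> \<beta> n x \<partial>jacobi_measure \<alpha> \<beta>) = c * jacobi_sigma \<alpha> \<beta> n"
proof -
  let ?P = "jacobi_poly \<alpha> \<beta> n" and ?M = "jacobi_measure \<alpha> \<beta>"
  define p where "p = q - smult c (jacobi_polynomial \<alpha> \<beta> n)"
  have "(\<integral>x. poly p x * ?P x \<partial>?M) = 0"
  \<comment> \<open>The zero polynomial has degree \<open>0\<close>, so the strict degree bound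
    would fail for it when \<open>n = 0\<close>.\<close>
  proof (cases "p = 0")
    case False
    have "degree p \<le> n" unfolding p_def
      using q degree_jacobi_polynomial[of \<alpha> \<beta> n]
      by (intro degree_diff_le) (auto intro: order_trans[OF degree_smult_le])
    moreover have "coeff p n = 0" using lead by (simp add: p_def)
    ultimately have "degree p < n" using False
      by (metis leading_coeff_0_iff le_neq_implies_less)
    then show ?thesis using ab by (intro jacobi_orthogonal_lower_degree)
  qed simp
  moreover have "poly q x * ?P x = poly p x * ?P x + c * (?P x * ?P x)" for x
    by (simp add: p_def poly_jacobi_polynomial algebra_simps)
  moreover have "integrable ?M (\<lambda>x. v x * ?P x)" if "continuous_on {-1..1} v" for v
    using ab that by (intro square_integrable_mult square_integrable_jacobi_continuous continuous_intros)
  ultimately show ?thesis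
    by (simp add: jacobi_sigma_eq power2_eq_square continuous_intros)
qed

text \<open>One integration by parts of the squared polynomial leaves its derivative, whose leading
  coefficient is (n + alpha + beta + 2)/2 times that of the polynomial with raised parameters. This
  recursion takes the place of the closed form by Gamma functions.\<close>

lemma jacobi_sigma_Suc:
  assumes ab: "\<alpha> > -1" "\<beta> > -1"
  shows "jacobi_sigma \<alpha> \<beta> (Suc n) =
    (real n + \<alpha> + \<beta> + 2) / (4 * real (Suc n)) * jacobi_sigma (\<alpha> + 1) (\<beta> + 1) n"
proof -
  let ?P = "jacobi_polynomial \<alpha> \<beta> (Suc n)" and ?Q = "jacobi_polynomial (\<alpha> + 1) (\<beta> + 1) n"
  \<comment> \<open>Lowering the degree by one and raising both parameters by one leaves this number
    unchanged, so both leading coefficients are binomials of the same \<open>a\<close>.\<close>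
  define a where "a = 2 * real (Suc n) + \<alpha> + \<beta>"
  have a: "2 * real n + (\<alpha> + 1) + (\<beta> + 1) = a" by (simp add: a_def)
  have "coeff (pderiv ?P) n = real (Suc n) * ((a gchoose Suc n) / 2 ^ Suc n)"
    by (simp only: coeff_pderiv coeff_jacobi_polynomial a_def)
  also have "\<dots> = ((a gchoose Suc n) * (1 + real n)) / 2 ^ Suc n" by simp
  also have "\<dots> = (real n + \<alpha> + \<beta> + 2) / 2 * coeff ?Q n"
    unfolding gbinomial_Suc_mult coeff_jacobi_polynomial a
    by (simp add: a_def algebra_simps)
  finally have "(\<integral>x. poly (pderiv ?P) x * jacobi_poly (\<alpha> + 1) (\<beta> + 1) n x \<partial>jacobi_measure (\<alpha> + 1) (\<beta> + 1)) =
      (real n + \<alpha> + \<beta> + 2) / 2 * jacobi_sigma (\<alpha> + 1) (\<beta> + 1) n"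
    using ab degree_jacobi_polynomial[of \<alpha> \<beta> "Suc n"]
    by (intro integral_jacobi_poly_leading) (auto simp: degree_pderiv)
  moreover have "jacobi_sigma \<alpha> \<beta> (Suc n) =
      (\<integral>x. poly ?P x * jacobi_poly \<alpha> \<beta> (Suc n) x \<partial>jacobi_measure \<alpha> \<beta>)"
    by (simp add: jacobi_sigma_eq poly_jacobi_polynomial power2_eq_square)
  moreover have "\<dots> = (\<integral>x. poly (pderiv ?P) x * jacobi_poly (\<alpha> + 1) (\<beta> + 1) n x \<partial>jacobi_measure (\<alpha> + 1) (\<beta> + 1)) / (2 * real (Suc n))"
    using ab by (intro jacobi_integration_by_parts) (auto intro!: continuous_intros poly_DERIV)
  ultimately have "jacobi_sigma \<alpha> \<beta> (Suc n) =
      (real n + \<alpha> + \<beta> + 2) / 2 * jacobi_sigma (\<alpha> + 1) (\<beta> + 1) n / (2 * real (Suc n))"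
    by (simp only:)
  then show ?thesis by (simp add: field_simps)
qed

text \<open>The recursion has positive factors and ends at the total mass of the weight.\<close>

lemma jacobi_sigma_pos: "\<alpha> > -1 \<Longrightarrow> \<beta> > -1 \<Longrightarrow> jacobi_sigma \<alpha> \<beta> n > 0"
proof (induction n arbitrary: \<alpha> \<beta>)
  case 0
  then show ?case
    using integral_jacobi_weight_pos[of \<alpha> \<beta>] by (simp add: jacobi_sigma_def jacobi_poly_def)
next
  case (Suc n)
  then show ?case
    unfolding jacobi_sigma_Suc[OF Suc.prems] by (intro mult_pos_pos Suc.IH divide_pos_pos) auto
qed

lemma orthogonal_system_jacobi:
  assumes ab: "\<alpha> > -1" "\<beta> > -1"
  shows "orthogonal_system (jacobi_measure \<alpha> \<beta>) (jacobi_poly \<alpha> \<beta>)"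
proof
  let ?P = "jacobi_poly \<alpha> \<beta>" and ?M = "jacobi_measure \<alpha> \<beta>"
  show "square_integrable ?M (?P n)" for n
    using ab by (intro square_integrable_jacobi_continuous continuous_intros)
  have less: "(\<integral>x. ?P m x * ?P n x \<partial>?M) = 0" if "m < n" for m n
    using jacobi_orthogonal_lower_degree[OF ab, of "jacobi_polynomial \<alpha> \<beta> m" n]
      degree_jacobi_polynomial[of \<alpha> \<beta> m] that by (simp add: poly_jacobi_polynomial)
  show "(\<integral>x. ?P m x * ?P n x \<partial>?M) = 0" if "m \<noteq> n" for m n
    using that less[of m n] less[of n m] by (cases "m < n") (auto simp: mult.commute)
  show "(\<integral>x. (?P n x)\<^sup>2 \<partial>?M) > 0" for n
    using jacobi_sigma_pos[OF ab] by (simp add: jacobi_sigma_eq)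
qed

lemma polynomial_jacobi_expansion:
  assumes ab: "\<alpha> > -1" "\<beta> > -1"
  shows "degree q \<le> N \<Longrightarrow> \<exists>d. \<forall>x. poly q x = (\<Sum>n\<le>N. d n * jacobi_poly \<alpha> \<beta> n x)"
proof (induction N arbitrary: q)
  let ?J = "jacobi_polynomial \<alpha> \<beta>"
  \<comment> \<open>Otherwise \<open>integral_jacobi_poly_leading\<close> with the factor
    \<open>0\<close> would make the polynomial orthogonal to itself, against
    \<open>jacobi_sigma_pos\<close>.\<close>
  have lead: "coeff (?J n) n \<noteq> 0" for n
  proof
    assume "coeff (?J n) n = 0"
    then have "(\<integral>x. poly (?J n) x * jacobi_poly \<alpha> \<beta> n x \<partial>jacobi_measure \<alpha> \<beta>) = 0 * jacobi_sigma \<alpha> \<beta> n"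
      using ab degree_jacobi_polynomial by (intro integral_jacobi_poly_leading) auto
    with jacobi_sigma_pos[OF ab, of n] show False
      by (simp add: jacobi_sigma_eq poly_jacobi_polynomial power2_eq_square)
  qed
  {
    case 0
    then obtain c where "q = [:c:]" by (metis degree_eq_zeroE le_zero_eq)
    then show ?case by (intro exI[of _ "\<lambda>_. c"]) (simp add: jacobi_poly_def)
  next
    case (Suc N)
    define c where "c = coeff q (Suc N) / coeff (?J (Suc N)) (Suc N)"
    define p where "p = q - smult c (?J (Suc N))"
    have "degree p \<le> Suc N" unfolding p_def
      using Suc.prems degree_jacobi_polynomial[of \<alpha> \<beta> "Suc N"]
      by (intro degree_diff_le) (auto intro: order_trans[OF degree_smult_le])
    moreover have "coeff p (Suc N) = 0" using lead[of "Suc N"] by (simp add: p_def c_def)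
    ultimately have "degree p \<le> N"
      by (metis degree_0 leading_coeff_0_iff le_Suc_eq zero_le)
    then obtain d where d: "\<And>x. poly p x = (\<Sum>n\<le>N. d n * jacobi_poly \<alpha> \<beta> n x)"
      using Suc.IH by blast
    have "poly q x = (\<Sum>n\<le>Suc N. (d(Suc N := c)) n * jacobi_poly \<alpha> \<beta> n x)" for x
    proof -
      have "poly q x = poly p x + c * jacobi_poly \<alpha> \<beta> (Suc N) x"
        by (simp add: p_def poly_jacobi_polynomial)
      also have "poly p x = (\<Sum>n\<le>N. (d(Suc N := c)) n * jacobi_poly \<alpha> \<beta> n x)"
        unfolding d by (intro sum.cong) auto
      finally show ?thesis by simp
    qed
    then show ?case by blast
  }
qed

section \<open>The projection error under differentiation\<close>

abbreviation jacobi_err :: "real \<Rightarrow> real \<Rightarrow> (real \<Rightarrow> real) \<Rightarrow> nat \<Rightarrow> real" where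
  "jacobi_err \<alpha> \<beta> \<equiv> orthogonal_system.err (jacobi_measure \<alpha> \<beta>) (jacobi_poly \<alpha> \<beta>)"

text \<open>Weierstrass approximation combined with minimality of the projection: a uniformly close
  polynomial is also close in the norm, the weight having finite mass.\<close>

lemma jacobi_err_continuous_tendsto_0:
  assumes ab: "\<alpha> > -1" "\<beta> > -1" and u: "continuous_on {-1..1} u" and "e > 0"
  shows "\<exists>N. jacobi_err \<alpha> \<beta> u N < e"
proof -
  let ?M = "jacobi_measure \<alpha> \<beta>"
  interpret orthogonal_system ?M "jacobi_poly \<alpha> \<beta>"
    by (rule orthogonal_system_jacobi[OF ab])
  note sq = square_integrable_jacobi_continuous[OF ab]
  have fin: "integrable ?M (\<lambda>x. c)" for c :: real
    using ab by (intro integrable_jacobi_measure_bounded[where B="\<bar>c\<bar>"]) auto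
  define m where "m = (\<integral>x. (1::real) \<partial>?M)"
  have m: "m \<ge> 0" unfolding m_def by simp
  \<comment> \<open>Chosen so that \<open>\<delta>\<^sup>2 * m < e\<close>; the summand
    \<open>1\<close> covers \<open>m = 0\<close>.\<close>
  define \<delta> where "\<delta> = sqrt (e / (2 * (m + 1)))"
  have "\<delta> > 0" using m \<open>e > 0\<close> by (simp add: \<delta>_def)
  then obtain h where h: "real_polynomial_function h" "\<And>x. x \<in> {-1..1} \<Longrightarrow> \<bar>u x - h x\<bar> < \<delta>"
    using Stone_Weierstrass_real_polynomial_function[of "{-1..1}" u \<delta>] u by auto
  obtain a N where a: "h = (\<lambda>x. \<Sum>i\<le>N. a i * x ^ i)"
    using h(1) unfolding real_polynomial_function_iff_sum by blast
  define q where "q = (\<Sum>i\<le>N. monom (a i) i)"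
  have "degree q \<le> N"
    unfolding q_def by (intro degree_sum_le) (auto intro: order_trans[OF degree_monom_le])
  then obtain d where d: "\<And>x. poly q x = (\<Sum>n\<le>N. d n * jacobi_poly \<alpha> \<beta> n x)"
    using polynomial_jacobi_expansion[OF ab] by blast
  have hq: "h x = poly q x" for x by (simp add: a q_def poly_sum poly_monom)
  have "err u N \<le> (\<integral>x. (u x - h x)\<^sup>2 \<partial>?M)"
    unfolding hq d by (intro err_le_combination sq u)
  also have "\<dots> \<le> (\<integral>x. \<delta>\<^sup>2 \<partial>?M)"
  proof (rule integral_mono)
    have "square_integrable ?M (\<lambda>x. u x - h x)"
      unfolding hq by (intro sq continuous_intros u)
    then show "integrable ?M (\<lambda>x. (u x - h x)\<^sup>2)" by (simp add: square_integrable_def)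
    show "(u x - h x)\<^sup>2 \<le> \<delta>\<^sup>2" if "x \<in> space ?M" for x
      using h(2)[of x] that \<open>\<delta> > 0\<close> by (intro power2_le_iff_abs_le[THEN iffD2]) auto
  qed (rule fin)
  also have "\<dots> = \<delta>\<^sup>2 * m" by (simp add: m_def)
  also have "\<dots> < e"
    using m \<open>e > 0\<close> by (auto simp: \<delta>_def field_simps intro!: add_nonneg_pos)
  finally show ?thesis by blast
qed

text \<open>By Parseval it suffices to compare the squared coefficients beyond the cut term by term,
  the index \<open>Suc n\<close> of \<open>u\<close> matching the index \<open>n\<close> of
  \<open>u'\<close>.\<close>

lemma jacobi_err_derivative:
  assumes ab: "\<alpha> > -1" "\<beta> > -1"
    and u: "continuous_on {-1..1} u" and u': "continuous_on {-1..1} u'"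
    and deriv: "\<And>x. x \<in> {-1<..<1} \<Longrightarrow> (u has_real_derivative u' x) (at x)"
  shows "jacobi_err \<alpha> \<beta> u (Suc N) \<le> jacobi_err (\<alpha> + 1) (\<beta> + 1) u' N / (real (Suc N))\<^sup>2"
proof -
  interpret J: orthogonal_system "jacobi_measure \<alpha> \<beta>" "jacobi_poly \<alpha> \<beta>"
    by (rule orthogonal_system_jacobi[OF ab])
  interpret K: orthogonal_system "jacobi_measure (\<alpha> + 1) (\<beta> + 1)" "jacobi_poly (\<alpha> + 1) (\<beta> + 1)"
    using ab by (intro orthogonal_system_jacobi) auto
  have sq: "square_integrable (jacobi_measure \<alpha> \<beta>) u" "square_integrable (jacobi_measure (\<alpha> + 1) (\<beta> + 1)) u'"
    using ab u u' by (intro square_integrable_jacobi_continuous; simp)+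
  let ?c = "\<lambda>n. (J.coeff u n)\<^sup>2 * jacobi_sigma \<alpha> \<beta> n"
  let ?d = "\<lambda>n. (K.coeff u' n)\<^sup>2 * jacobi_sigma (\<alpha> + 1) (\<beta> + 1) n"
  have J: "J.err u N = (\<integral>x. (u x)\<^sup>2 \<partial>jacobi_measure \<alpha> \<beta>) - (\<Sum>n\<le>N. ?c n)" for N
    by (simp add: J.err_eq[OF sq(1)] jacobi_sigma_eq)
  have K: "K.err u' N = (\<integral>x. (u' x)\<^sup>2 \<partial>jacobi_measure (\<alpha> + 1) (\<beta> + 1)) - (\<Sum>n\<le>N. ?d n)" for N
    by (simp add: K.err_eq[OF sq(2)] jacobi_sigma_eq)
  have d_nonneg: "?d n \<ge> 0" for n
    using ab jacobi_sigma_pos[of "\<alpha> + 1" "\<beta> + 1" n] by (intro mult_nonneg_nonneg) auto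
  \<comment> \<open>The exact ratio is 1/(k (n + 1)) with k = n + alpha + beta + 2. From alpha +
    beta + 2 > 0 one gets k > n, and \<open>n > N\<close> then makes both factors at least N +
    1.\<close>
  have step: "?c (Suc n) \<le> ?d n / (real (Suc N))\<^sup>2" if "n > N" for n
  proof -
    let ?s = "jacobi_sigma (\<alpha> + 1) (\<beta> + 1) n"
    have s: "?s > 0" using ab by (intro jacobi_sigma_pos) auto
    define k where "k = real n + \<alpha> + \<beta> + 2"
    have k: "k > 0" "real (Suc N) \<le> k" using ab that by (auto simp: k_def)
    have "J.coeff u (Suc n) = K.coeff u' n * ?s / (2 * real (Suc n)) / jacobi_sigma \<alpha> \<beta> (Suc n)"
      using s jacobi_integration_by_parts[OF ab u u' deriv, of n]
      by (simp add: J.coeff_def K.coeff_def jacobi_sigma_eq[symmetric])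
    also have "\<dots> = 2 / k * K.coeff u' n"
      using s k unfolding jacobi_sigma_Suc[OF ab] k_def[symmetric] by (simp add: field_simps del: of_nat_Suc)
    finally have c: "J.coeff u (Suc n) = 2 / k * K.coeff u' n" .
    have "?c (Suc n) = ?d n / (k * real (Suc n))"
      using s k unfolding c jacobi_sigma_Suc[OF ab] k_def[symmetric]
      by (simp add: field_simps power2_eq_square del: of_nat_Suc)
    also have "\<dots> \<le> ?d n / (real (Suc N))\<^sup>2"
      unfolding power2_eq_square using k that d_nonneg[of n]
      by (intro divide_left_mono mult_mono mult_pos_pos) (auto simp: power2_eq_square)
    finally show ?thesis .
  qed
  \<comment> \<open>Tails are compared on finite blocks, as differences of errors, which avoids
    infinite series.\<close>
  have bound: "J.err u (Suc N) \<le> J.err u (Suc (N + i)) + (K.err u' N - K.err u' (N + i)) / (real (Suc N))\<^sup>2" for i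
  proof (induction i)
    case (Suc i)
    have "J.err u (Suc (N + i)) = J.err u (Suc (N + Suc i)) + ?c (Suc (N + Suc i))"
      by (simp add: J)
    moreover have "?c (Suc (N + Suc i)) \<le> ?d (N + Suc i) / (real (Suc N))\<^sup>2"
      by (rule step) simp
    moreover have "?d (N + Suc i) = K.err u' (N + i) - K.err u' (N + Suc i)"
      by (simp add: K)
    ultimately show ?case using Suc.IH by (simp add: diff_divide_distrib)
  qed simp
  have antimono: "J.err u (N + i) \<le> J.err u N" for N i
    unfolding J using jacobi_sigma_pos[OF ab]
    by (intro diff_left_mono sum_mono2 mult_nonneg_nonneg) (auto intro: less_imp_le)
  show ?thesis
  \<comment> \<open>Completeness is used for \<open>u\<close> alone: its tail beyond the block
    becomes small, while the tail of \<open>u'\<close> is merely nonnegative and is dropped.\<close>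
  proof (rule field_le_epsilon)
    fix e :: real assume "e > 0"
    then obtain i where i: "J.err u i < e"
      using jacobi_err_continuous_tendsto_0[OF ab u] by blast
    have "J.err u (Suc N) \<le> J.err u (Suc (N + i)) + (K.err u' N - K.err u' (N + i)) / (real (Suc N))\<^sup>2"
      by (rule bound)
    also have "\<dots> \<le> e + K.err u' N / (real (Suc N))\<^sup>2"
      using antimono[of i "Suc N"] i K.err_nonneg[of u' "N + i"]
      by (intro add_mono divide_right_mono) (auto simp: add.commute)
    finally show "J.err u (Suc N) \<le> K.err u' N / (real (Suc N))\<^sup>2 + e" by simp
  qed
qed

section \<open>Singular profiles\<close>

lemma C_infinity_on_imp_continuous_on: "C_infinity_on g S \<Longrightarrow> continuous_on S g"
proof -
  assume "C_infinity_on g S"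
  then obtain D where D: "\<And>x. x \<in> S \<Longrightarrow> D 0 x = g x"
      "\<And>k x. x \<in> S \<Longrightarrow> (D k has_real_derivative D (Suc k) x) (at x within S)"
    unfolding C_infinity_on_def by blast
  have "continuous_on S (D 0)"
    using D(2)[of _ 0] by (intro DERIV_continuous_on)
  then show ?thesis using D(1) by (simp cong: continuous_on_cong)
qed

lemma C_infinity_on_derivative:
  assumes "C_infinity_on g S"
  obtains g' where "C_infinity_on g' S"
    "\<And>x. x \<in> S \<Longrightarrow> (g has_real_derivative g' x) (at x within S)"
proof -
  obtain D where D: "\<And>x. x \<in> S \<Longrightarrow> D 0 x = g x"
      "\<And>k x. x \<in> S \<Longrightarrow> (D k has_real_derivative D (Suc k) x) (at x within S)"
    using assms unfolding C_infinity_on_def by blast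
  show thesis
  proof
    show "C_infinity_on (D 1) S"
      unfolding C_infinity_on_def using D(2) by (intro exI[of _ "\<lambda>k. D (Suc k)"]) auto
    show "(g has_real_derivative D 1 x) (at x within S)" if "x \<in> S" for x
      using has_derivative_transform[of x S g "D 0"] D(1) D(2)[OF that, of 0] that
      by (simp add: has_field_derivative_def)
  qed
qed

lemma C_infinity_on_cmult:
  assumes "C_infinity_on g S"
  shows "C_infinity_on (\<lambda>x. c * g x) S"
proof -
  obtain D where D: "\<And>x. x \<in> S \<Longrightarrow> D 0 x = g x"
      "\<And>k x. x \<in> S \<Longrightarrow> (D k has_real_derivative D (Suc k) x) (at x within S)"
    using assms unfolding C_infinity_on_def by blast
  then show ?thesis
    unfolding C_infinity_on_def by (intro exI[of _ "\<lambda>k x. c * D k x"]) (auto intro!: DERIV_cmult)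
qed

lemma C_infinity_on_linear_mult:
  assumes "C_infinity_on g S"
  shows "C_infinity_on (\<lambda>x. c * (x - z) * g x) S"
proof -
  obtain D where D: "\<And>x. x \<in> S \<Longrightarrow> D 0 x = g x"
      "\<And>k x. x \<in> S \<Longrightarrow> (D k has_real_derivative D (Suc k) x) (at x within S)"
    using assms unfolding C_infinity_on_def by blast
  \<comment> \<open>Leibniz' rule with a linear factor; for \<open>k = 0\<close> the truncated index
    \<open>k - 1\<close> is multiplied by \<open>0\<close>.\<close>
  have "((\<lambda>x. c * (x - z) * D k x + real k * c * D (k - 1) x) has_real_derivative
      c * (x - z) * D (Suc k) x + real (Suc k) * c * D k x) (at x within S)" if "x \<in> S" for k x
    using D(2)[OF that]
    by (cases k) (auto intro!: derivative_eq_intros simp: algebra_simps)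
  then show ?thesis
    unfolding C_infinity_on_def using D(1)
    by (intro exI[of _ "\<lambda>k x. c * (x - z) * D k x + real k * c * D (k - 1) x"]) auto
qed

lemma C_infinity_on_linear_power_mult:
  "C_infinity_on g S \<Longrightarrow> C_infinity_on (\<lambda>x. (c * (x - z)) ^ n * g x) S"
proof (induction n)
  case (Suc n)
  then show ?case
    using C_infinity_on_linear_mult[of "\<lambda>x. (c * (x - z)) ^ n * g x" S c z] by (simp add: mult.assoc)
qed simp

section \<open>Power-logarithm profiles and their flat cutoff\<close>

definition log_power :: "real \<Rightarrow> nat \<Rightarrow> real \<Rightarrow> real" where
  "log_power a b t = (if t > 0 then t powr a * ln t ^ b else 0)"

text \<open>The exponential is flat to infinite order at \<open>0\<close> and tends to
  \<open>1\<close> at infinity, so it acts as a cutoff near \<open>0\<close> whose derivatives stay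
  in the same family. Both profiles vanish for \<open>t \<le> 0\<close>, so that a singularity
  inside the interval is a sum of two, one for each side.\<close>

definition damped :: "real \<Rightarrow> real \<Rightarrow> nat \<Rightarrow> real \<Rightarrow> real" where
  "damped m a b t = log_power a b t * exp (- (t powr - m))"

lemma log_power_le_0 [simp]: "t \<le> 0 \<Longrightarrow> log_power a b t = 0"
  and damped_le_0 [simp]: "t \<le> 0 \<Longrightarrow> damped m a b t = 0"
  by (simp_all add: log_power_def damped_def)

lemma borel_measurable_log_power [measurable]: "log_power a b \<in> borel_measurable borel"
  unfolding log_power_def[abs_def] by measurable

lemma borel_measurable_damped [measurable]: "damped m a b \<in> borel_measurable borel"
  unfolding damped_def[abs_def] by measurable

text \<open>
  Moving one factor \<open>t\<close> from the profile to the smooth factor is what gives the terms without a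
  derivative of the profile the same exponent \<open>a - 1\<close> as the others in \<open>damped_err_bound\<close>.
\<close>

lemma damped_eq_mult: "damped m a b t = t * damped m (a - 1) b t"
  by (simp add: damped_def log_power_def powr_diff)

text \<open>Taking the larger of \<open>t\<close> and \<open>1 / t\<close> treats the logarithm near
  \<open>0\<close> and near infinity at once.\<close>

lemma ln_power_bound:
  assumes "\<eta> > 0"
  obtains C where "C > 0" "\<And>t::real. t > 0 \<Longrightarrow> \<bar>ln t\<bar> ^ b \<le> C * max t (1 / t) powr \<eta>"
proof -
  \<comment> \<open>The \<open>b\<close>-th power of the bound by \<open>?m powr s\<close> must not
    exceed \<open>?m powr \<eta>\<close>; the summand \<open>1\<close> covers
    \<open>b = 0\<close>.\<close>
  define s where "s = \<eta> / (real b + 1)"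
  have s: "s > 0" using assms by (simp add: s_def)
  show thesis
  proof (rule that[of "(1 / s) ^ b"])
    fix t :: real assume t: "t > 0"
    let ?m = "max t (1 / t)"
    have "?m \<ge> 1 \<and> \<bar>ln t\<bar> = ln ?m"
    proof (cases "t \<ge> 1")
      case True
      then have "1 / t \<le> t" by (intro order_trans[of "1 / t" 1 t]) auto
      then show ?thesis using True by (simp add: max_def)
    next
      case False
      then have "1 \<le> 1 / t" "t \<le> 1 / t" using t by (auto simp: field_simps mult_le_one)
      then show ?thesis using t False by (simp add: max_def ln_div)
    qed
    then have m: "?m \<ge> 1" and "\<bar>ln t\<bar> = ln ?m" by auto
    note this(2)
    also have "\<dots> \<le> (1 / s) * ?m powr s"
      using ln_powr_bound[OF m s] by simp
    finally have "\<bar>ln t\<bar> ^ b \<le> ((1 / s) * ?m powr s) ^ b"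
      by (intro power_mono) auto
    also have "\<dots> = (1 / s) ^ b * ?m powr (s * b)"
      using m by (simp add: power_divide powr_powr[symmetric] powr_realpow)
    also have "\<dots> \<le> (1 / s) ^ b * ?m powr \<eta>"
      using m s assms by (intro mult_left_mono powr_mono) (auto simp: s_def field_simps)
    finally show "\<bar>ln t\<bar> ^ b \<le> (1 / s) ^ b * ?m powr \<eta>" .
  qed (use s in simp)
qed

text \<open>With x = t^-m and q = p/m, the inequality ln (x/q) <= x/q gives exp(-x) <= q^q x^-q, and
  x^-q = t^p.\<close>

lemma exp_neg_powr_bound:
  assumes "m > 0" "p > 0"
  obtains C where "C > 0" "\<And>t::real. t > 0 \<Longrightarrow> exp (- (t powr - m)) \<le> C * t powr p"
proof -
  define q where "q = p / m"
  have q: "q > 0" using assms by (simp add: q_def)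
  show thesis
  proof (rule that[of "q powr q"])
    fix t :: real assume t: "t > 0"
    define s where "s = t powr - m"
    have s: "s > 0" using t by (simp add: s_def)
    have "q * ln (s / q) \<le> s"
      using ln_bound[of "s / q"] s q by (simp add: field_simps)
    then have "exp (- s) \<le> exp (q * ln (q / s))"
      using s q by (simp add: ln_div algebra_simps)
    also have "\<dots> = q powr q * s powr - q"
      using s q by (simp add: powr_def ln_div exp_add[symmetric] algebra_simps)
    also have "s powr - q = t powr p"
      using assms t by (simp add: s_def q_def powr_powr)
    finally show "exp (- (t powr - m)) \<le> q powr q * t powr p" by (simp add: s_def)
  qed (use q in simp)
qed

text \<open>One term for each of the three factors; for \<open>b = 0\<close> the truncated
  \<open>b - 1\<close> is multiplied by \<open>0\<close>. The point is that the formula also holds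
  at \<open>0\<close>, where all terms vanish by flatness.\<close>

lemma damped_has_derivative:
  assumes m: "m > 0"
  shows "(damped m a b has_real_derivative
    a * damped m (a - 1) b t + real b * damped m (a - 1) (b - 1) t + m * damped m (a - m - 1) b t) (at t)"
proof -
  consider "t > 0" | "t < 0" | "t = 0" by linarith
  then show ?thesis
  proof cases
    case 1
    have "((\<lambda>t. t powr a * ln t ^ b * exp (- (t powr - m))) has_real_derivative
        a * damped m (a - 1) b t + real b * damped m (a - 1) (b - 1) t + m * damped m (a - m - 1) b t) (at t)"
    proof (rule DERIV_cong[OF DERIV_mult[OF DERIV_mult]])
      show "((\<lambda>t. t powr a) has_real_derivative a * t powr (a - 1)) (at t)"
        by (rule has_real_derivative_powr[OF 1])
      show "((\<lambda>t. ln t ^ b) has_real_derivative real b * (1 / t) * ln t ^ (b - 1)) (at t)"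
        using 1 by (auto intro!: derivative_eq_intros simp: mult_ac)
      show "((\<lambda>t. exp (- (t powr - m))) has_real_derivative
          exp (- (t powr - m)) * (m * t powr (- m - 1))) (at t)"
        using 1 by (auto intro!: derivative_eq_intros)
      have "t powr (a - m - 1) = t powr a * t powr (- m - 1)"
        unfolding powr_add[symmetric] by (simp add: algebra_simps)
      then show "(a * t powr (a - 1) * ln t ^ b + real b * (1 / t) * ln t ^ (b - 1) * t powr a) *
            exp (- (t powr - m)) +
          exp (- (t powr - m)) * (m * t powr (- m - 1)) * (t powr a * ln t ^ b) =
        a * damped m (a - 1) b t + real b * damped m (a - 1) (b - 1) t + m * damped m (a - m - 1) b t"
        using 1 by (simp add: damped_def log_power_def powr_diff algebra_simps)
    qed
    then show ?thesis
    proof (rule DERIV_cong_ev[THEN iffD1, rotated 3, OF _ refl _ refl])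
      show "\<forall>\<^sub>F t in nhds t. t powr a * ln t ^ b * exp (- (t powr - m)) = damped m a b t"
        using 1 by (intro eventually_mono[OF eventually_nhds_in_open[of "{0<..}"]])
          (auto simp: damped_def log_power_def)
    qed
  next
    case 2
    have "((\<lambda>_. 0) has_real_derivative 0) (at t)" by simp
    then have "(damped m a b has_real_derivative 0) (at t)"
    proof (rule DERIV_cong_ev[THEN iffD1, rotated 3, OF _ refl _ refl])
      show "\<forall>\<^sub>F t in nhds t. 0 = damped m a b t"
        using 2 by (intro eventually_mono[OF eventually_nhds_in_open[of "{..<0}"]]) auto
    qed
    with 2 show ?thesis by simp
  next
    case 3
    obtain C where C: "C > 0" "\<And>t::real. t > 0 \<Longrightarrow> \<bar>ln t\<bar> ^ b \<le> C * max t (1 / t) powr 1"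
      using ln_power_bound[OF zero_less_one, of b] by blast
    \<comment> \<open>This makes the final exponent \<open>a - 1 + p\<close> at least
      \<open>2\<close>, the \<open>- 1\<close> paying for the logarithm; a quadratic bound gives the
      derivative \<open>0\<close>.\<close>
    define p where "p = max 1 (3 - a)"
  have p: "p > 0" by (simp add: p_def)
    obtain K where K: "K > 0" "\<And>t::real. t > 0 \<Longrightarrow> exp (- (t powr - m)) \<le> K * t powr p"
      using exp_neg_powr_bound[OF m p] by blast
    have bound: "\<bar>damped m a b h\<bar> \<le> C * K * h\<^sup>2" if "\<bar>h\<bar> < 1" for h
    proof (cases "h > 0")
      case True
      have "\<bar>damped m a b h\<bar> = h powr a * \<bar>ln h\<bar> ^ b * exp (- (h powr - m))"
        using True by (simp add: damped_def log_power_def abs_mult power_abs)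
      also have "\<dots> \<le> h powr a * (C * h powr - 1) * (K * h powr p)"
      proof (intro mult_mono mult_left_mono K(2) True)
        have "h \<le> 1 / h" using True that by (simp add: field_simps mult_le_one)
        then show "\<bar>ln h\<bar> ^ b \<le> C * h powr - 1"
          using C(2)[OF True] True by (simp add: max_def powr_minus_divide)
      qed (use C(1) K(1) in auto)
      also have "\<dots> = C * K * h powr (a - 1 + p)"
        by (simp add: powr_add powr_diff powr_minus field_simps)
      also have "\<dots> \<le> C * K * h powr 2"
        using True that C(1) K(1) by (intro mult_left_mono powr_mono') (auto simp: p_def)
      finally show ?thesis using True by (simp add: powr_numeral)
    qed (use C(1) K(1) in auto)
    have "((\<lambda>h. damped m a b h / h) \<longlongrightarrow> 0) (at 0)"
    proof (rule Lim_null_comparison)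
      show "\<forall>\<^sub>F h in at 0. norm (damped m a b h / h) \<le> C * K * \<bar>h\<bar>"
        unfolding eventually_at using bound
        by (intro exI[of _ 1]) (auto simp: abs_divide field_simps power2_eq_square)
      show "((\<lambda>h. C * K * \<bar>h\<bar>) \<longlongrightarrow> 0) (at (0::real))"
        by (auto intro!: tendsto_eq_intros)
    qed
    then show ?thesis unfolding 3 DERIV_def by simp
  qed
qed

lemma continuous_on_damped: "m > 0 \<Longrightarrow> continuous_on UNIV (damped m a b)"
  by (intro continuous_at_imp_continuous_on ballI DERIV_isCont[OF damped_has_derivative])

text \<open>One integrable profile for all estimates in the scaled variable: the exponent at
  \<open>0\<close> is adjustable, the decay at infinity fixed. Undoing the scaling multiplies its
  integral by \<open>e\<close>.\<close>

definition tail_majorant :: "real \<Rightarrow> real \<Rightarrow> real" where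
  "tail_majorant \<theta> t = (if t \<le> 0 then 0 else if t \<le> 1 then t powr \<theta> else t powr -2)"

lemma tail_majorant_nonneg [simp]: "0 \<le> tail_majorant \<theta> t"
  by (simp add: tail_majorant_def)

lemma integrable_tail_majorant:
  assumes "\<theta> > -1"
  shows "integrable lborel (tail_majorant \<theta>)"
proof -
  have A: "set_integrable lborel {0..1} (\<lambda>t::real. t powr \<theta>)"
  proof -
    have "(\<lambda>t. t powr \<theta>) absolutely_integrable_on {0..1}"
      using integrable_on_powr_from_0[OF assms, of 1] by (subst absolutely_integrable_on_iff_nonneg) auto
    then show ?thesis
      unfolding set_integrable_def by (subst (asm) integrable_completion) auto
  qed
  have B: "set_integrable lborel {1..} (\<lambda>t::real. t powr -2)"
  proof -
    have "(\<lambda>t::real. t powr -2) integrable_on {1..}"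
      using has_integral_powr_to_inf[of "-2" 1] by (auto simp: integrable_on_def)
    then have "(\<lambda>t::real. t powr -2) absolutely_integrable_on {1..}"
      by (subst absolutely_integrable_on_iff_nonneg) auto
    then show ?thesis
      unfolding set_integrable_def by (subst (asm) integrable_completion) auto
  qed
  show ?thesis
  proof (rule Bochner_Integration.integrable_bound)
    show "integrable lborel (\<lambda>t::real. indicator {0..1} t *\<^sub>R t powr \<theta> + indicator {1..} t *\<^sub>R t powr -2)"
      using A B unfolding set_integrable_def by (rule Bochner_Integration.integrable_add)
    show "tail_majorant \<theta> \<in> borel_measurable lborel"
      unfolding tail_majorant_def[abs_def] by measurable
  qed (auto simp: tail_majorant_def indicator_def)
qed

lemma log_power_square:
  assumes "t > 0"
  shows "(log_power a b t)\<^sup>2 = t powr (2 * a) * \<bar>ln t\<bar> ^ (2 * b)"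
proof -
  have "(t powr a)\<^sup>2 = t powr (2 * a)"
    unfolding power2_eq_square powr_add[symmetric] by simp
  moreover have "(ln t ^ b)\<^sup>2 = \<bar>ln t\<bar> ^ (2 * b)"
    unfolding power_even_abs[OF dvd_triv_left] by (metis power_mult mult.commute)
  ultimately show ?thesis using assms by (simp add: log_power_def power_mult_distrib)
qed

lemma log_power_square_bound:
  assumes "\<eta> > 0"
  obtains C where "C > 0"
    "\<And>t. 0 < t \<Longrightarrow> t \<le> 1 \<Longrightarrow> (log_power a b t)\<^sup>2 \<le> C * t powr (2 * a - \<eta>)"
    "\<And>t. 1 \<le> t \<Longrightarrow> (log_power a b t)\<^sup>2 \<le> C * t powr (2 * a + \<eta>)"
proof -
  obtain C where C: "C > 0" "\<And>t::real. t > 0 \<Longrightarrow> \<bar>ln t\<bar> ^ (2 * b) \<le> C * max t (1 / t) powr \<eta>"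
    using ln_power_bound[OF assms] by blast
  have *: "(log_power a b t)\<^sup>2 \<le> C * (t powr (2 * a) * max t (1 / t) powr \<eta>)" if "t > 0" for t
  proof -
    have "(log_power a b t)\<^sup>2 = t powr (2 * a) * \<bar>ln t\<bar> ^ (2 * b)"
      using that by (rule log_power_square)
    also have "\<dots> \<le> t powr (2 * a) * (C * max t (1 / t) powr \<eta>)"
      by (intro mult_left_mono C that) auto
    finally show ?thesis by (simp add: mult_ac)
  qed
  show thesis
  proof (rule that[OF C(1)])
    fix t :: real assume t: "0 < t" "t \<le> 1"
    then have "t \<le> 1 / t" by (simp add: field_simps mult_le_one)
    then have "max t (1 / t) = 1 / t" by (simp add: max_def)
    with t show "(log_power a b t)\<^sup>2 \<le> C * t powr (2 * a - \<eta>)"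
      using *[of t] by (simp add: powr_divide powr_diff)
  next
    fix t :: real assume t: "1 \<le> t"
    then have "1 / t \<le> 1" by simp
    with t have "1 / t \<le> t" by linarith
    then have "max t (1 / t) = t" by (simp add: max_def)
    with t show "(log_power a b t)\<^sup>2 \<le> C * t powr (2 * a + \<eta>)"
      using *[of t] by (simp add: powr_add)
  qed
qed

text \<open>Near \<open>0\<close> the exponential beats every power, so \<open>\<theta>\<close> is
  free. For \<open>t > 1\<close> it is only bounded by \<open>1\<close>, and the hypothesis on
  \<open>a\<close> leaves \<open>t powr -2\<close> after one power is spent on the
  logarithm.\<close>

lemma damped_tail_majorant:
  assumes m: "m > 0" and a: "2 * a + \<rho> \<le> -3"
  obtains C where "C > 0" "\<And>t. t > 0 \<Longrightarrow> (damped m a b t)\<^sup>2 * t powr \<rho> \<le> C * tail_majorant \<theta> t"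
proof -
  obtain C where C: "C > 0"
    "\<And>t. 0 < t \<Longrightarrow> t \<le> 1 \<Longrightarrow> (log_power a b t)\<^sup>2 \<le> C * t powr (2 * a - 1)"
    "\<And>t. 1 \<le> t \<Longrightarrow> (log_power a b t)\<^sup>2 \<le> C * t powr (2 * a + 1)"
    by (rule log_power_square_bound[of 1 a b]) auto
  \<comment> \<open>Makes the exponent \<open>2 * a - 1 + p + \<rho>\<close> near \<open>0\<close>
    at least \<open>\<theta>\<close>; the bound \<open>1\<close> keeps \<open>p\<close>
    positive.\<close>
  define p where "p = max 1 (\<theta> + 1 - 2 * a - \<rho>)"
  have p: "p > 0" by (simp add: p_def)
  obtain K where K: "K > 0" "\<And>t::real. t > 0 \<Longrightarrow> exp (- (t powr - m)) \<le> K * t powr p"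
    using exp_neg_powr_bound[OF m p] by blast
  have E: "(exp (- (t powr - m)))\<^sup>2 \<le> exp (- (t powr - m))" for t
    by (simp add: power2_eq_square)
  show thesis
  proof (rule that[of "C * (K + 1)"])
    fix t :: real assume t: "t > 0"
    show "(damped m a b t)\<^sup>2 * t powr \<rho> \<le> C * (K + 1) * tail_majorant \<theta> t"
    proof (cases "t \<le> 1")
      case True
      have "(damped m a b t)\<^sup>2 * t powr \<rho> \<le> (C * t powr (2 * a - 1)) * (K * t powr p) * t powr \<rho>"
        unfolding damped_def power_mult_distrib
        using C(1) C(2)[OF t True] K(1) order_trans[OF E K(2)[OF t]]
        by (intro mult_right_mono mult_mono) auto
      also have "\<dots> = C * K * (t powr (2 * a - 1) * t powr p * t powr \<rho>)"
        by (simp only: mult_ac)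
      also have "\<dots> = C * K * t powr (2 * a - 1 + p + \<rho>)"
        by (simp only: powr_add)
      also have "\<dots> \<le> C * K * t powr \<theta>"
        using C(1) K(1) t True by (intro mult_left_mono powr_mono') (auto simp: p_def)
      also have "\<dots> \<le> C * (K + 1) * t powr \<theta>"
        using C(1) by (intro mult_right_mono mult_left_mono) auto
      finally show ?thesis using t True by (simp add: tail_majorant_def)
    next
      case False
      have "(damped m a b t)\<^sup>2 * t powr \<rho> \<le> (C * t powr (2 * a + 1)) * 1 * t powr \<rho>"
        unfolding damped_def power_mult_distrib
        using C(1) C(3)[of t] False order_trans[OF E, of t 1]
        by (intro mult_right_mono mult_mono) auto
      also have "\<dots> = C * t powr (2 * a + 1 + \<rho>)"
        by (simp only: powr_add mult_1_right mult.assoc)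
      also have "\<dots> \<le> C * t powr -2"
        using C(1) False a by (intro mult_left_mono powr_mono) auto
      also have "\<dots> \<le> C * (K + 1) * t powr -2"
        using C(1) K(1) by (intro mult_right_mono) auto
      finally show ?thesis using t False by (simp add: tail_majorant_def)
    qed
  qed (use C(1) K(1) in simp)
qed

text \<open>Rests on 1 - exp(-x) <= min 1 x. The bound by \<open>1\<close> serves near the
  singularity, the bound by \<open>t powr - m\<close> gives decay at infinity.\<close>

lemma log_power_minus_damped_square_le:
  assumes "(log_power a b t)\<^sup>2 \<le> A" "min 1 (t powr - m) \<le> B"
  shows "(log_power a b t - damped m a b t)\<^sup>2 \<le> A * B\<^sup>2"
proof -
  have "0 \<le> 1 - exp (- (t powr - m))" by simp
  moreover have "1 - exp (- (t powr - m)) \<le> B"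
    using exp_ge_add_one_self[of "- (t powr - m)"] exp_gt_zero[of "- (t powr - m)"] assms(2)
    by linarith
  ultimately have "(log_power a b t)\<^sup>2 * (1 - exp (- (t powr - m)))\<^sup>2 \<le> A * B\<^sup>2"
    using assms(1) by (intro mult_mono power_mono) (auto intro: order_trans[OF zero_le_power2])
  moreover have "log_power a b t - damped m a b t = log_power a b t * (1 - exp (- (t powr - m)))"
    by (simp add: damped_def right_diff_distrib)
  ultimately show ?thesis by (simp only: power_mult_distrib)
qed

lemma log_power_minus_damped_tail_majorant:
  assumes a: "2 * a + \<rho> > -1" and m: "2 * a + \<rho> - 2 * m \<le> -3"
  obtains C where "C > 0"
    "\<And>t. t > 0 \<Longrightarrow> (log_power a b t - damped m a b t)\<^sup>2 * t powr \<rho>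
      \<le> C * tail_majorant ((2 * a + \<rho> - 1) / 2) t"
proof -
  \<comment> \<open>The margin in \<open>2 * a + \<rho> > -1\<close> is halved: one half pays for
    the logarithm near \<open>0\<close>, and the remaining exponent \<open>?\<theta>\<close> lies
    midway between \<open>-1\<close> and \<open>2 * a + \<rho>\<close>.\<close>
  let ?\<eta> = "(2 * a + \<rho> + 1) / 2" and ?\<theta> = "(2 * a + \<rho> - 1) / 2"
  let ?v = "\<lambda>t. log_power a b t - damped m a b t"
  have \<eta>: "?\<eta> > 0" using a by simp
  obtain C where C: "C > 0"
    "\<And>t. 0 < t \<Longrightarrow> t \<le> 1 \<Longrightarrow> (log_power a b t)\<^sup>2 \<le> C * t powr (2 * a - ?\<eta>)"
    "\<And>t. 1 \<le> t \<Longrightarrow> (log_power a b t)\<^sup>2 \<le> C * t powr (2 * a + ?\<eta>)"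
    by (rule log_power_square_bound[OF \<eta>, of a b]) (rule that)
  \<comment> \<open>For \<open>t \<ge> 1\<close> a full power goes to the logarithm; the hypothesis
    on \<open>m\<close> still leaves \<open>t powr -2\<close>.\<close>
  obtain K where K: "K > 0"
    "\<And>t. 0 < t \<Longrightarrow> t \<le> 1 \<Longrightarrow> (log_power a b t)\<^sup>2 \<le> K * t powr (2 * a - 1)"
    "\<And>t. 1 \<le> t \<Longrightarrow> (log_power a b t)\<^sup>2 \<le> K * t powr (2 * a + 1)"
    by (rule log_power_square_bound[OF zero_less_one, of a b]) (rule that)
  show thesis
  proof (rule that[of "C + K"])
    fix t :: real assume t: "t > 0"
    show "(?v t)\<^sup>2 * t powr \<rho> \<le> (C + K) * tail_majorant ?\<theta> t"
    proof (cases "t \<le> 1")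
      case True
      have "(?v t)\<^sup>2 * t powr \<rho> \<le> (C * t powr (2 * a - ?\<eta>) * 1\<^sup>2) * t powr \<rho>"
        using t True by (intro mult_right_mono log_power_minus_damped_square_le C(2)) auto
      also have "\<dots> = C * t powr (2 * a - ?\<eta> + \<rho>)"
        by (simp only: powr_add power_one mult_1_right mult.assoc)
      also have "2 * a - ?\<eta> + \<rho> = ?\<theta>" by (simp add: field_simps)
      also have "C * t powr ?\<theta> \<le> (C + K) * t powr ?\<theta>"
        using C K by (intro mult_right_mono) auto
      finally show ?thesis using t True by (simp add: tail_majorant_def)
    next
      case False
      have "(?v t)\<^sup>2 * t powr \<rho> \<le> (K * t powr (2 * a + 1) * (t powr - m)\<^sup>2) * t powr \<rho>"
        using False by (intro mult_right_mono log_power_minus_damped_square_le K(3)) auto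
      also have "\<dots> = K * t powr (2 * a + 1 + (- m + - m) + \<rho>)"
        by (simp only: powr_add power2_eq_square mult.assoc)
      also have "\<dots> \<le> K * t powr -2"
        using K(1) False m by (intro mult_left_mono powr_mono) auto
      also have "\<dots> \<le> (C + K) * t powr -2"
        using C K by (intro mult_right_mono) auto
      finally show ?thesis using t False by (simp add: tail_majorant_def)
    qed
  qed (use C K in simp)
qed

text \<open>Away from the singularity the weight need not be bounded by the local power, since it
  may blow up at another end point. There the removed part is small pointwise, and the weight's own
  integrability does the rest.\<close>

lemma log_power_minus_damped_far:
  assumes \<rho>: "\<rho> > -1" and m: "2 * a + \<rho> - 2 * m \<le> -3" and \<delta>: "\<delta> > 0"
  obtains C where "C > 0"
    "\<And>t e. 0 < e \<Longrightarrow> e \<le> 1 \<Longrightarrow> t > \<delta> / e \<Longrightarrow> (log_power a b t - damped m a b t)\<^sup>2 \<le> C * e powr (\<rho> + 1)"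
proof -
  let ?v = "\<lambda>t. log_power a b t - damped m a b t"
  obtain L where L: "L > 0" "\<And>t::real. t > 0 \<Longrightarrow> \<bar>ln t\<bar> ^ (2 * b) \<le> L * max t (1 / t) powr 1"
    using ln_power_bound[OF zero_less_one, of "2 * b"] by blast
  \<comment> \<open>The exponent of \<open>t\<close> that results: \<open>2 * a\<close> from the
    power, \<open>1\<close> for the logarithm, \<open>- 2 * m\<close> from the cutoff.\<close>
  define \<kappa> where "\<kappa> = 2 * a + 1 - 2 * m"
  have \<kappa>: "\<kappa> \<le> 0" "- \<kappa> \<ge> \<rho> + 1" using \<rho> m by (auto simp: \<kappa>_def)
  define D where "D = L * (1 + 1 / \<delta>\<^sup>2) * \<delta> powr \<kappa>"
  show thesis
  proof (rule that[of D])
    fix t e :: real assume e: "0 < e" "e \<le> 1" and te: "t > \<delta> / e"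
    have "\<delta> \<le> \<delta> / e" using e \<delta> by (simp add: field_simps)
    with te \<delta> have t: "t > 0" "t \<ge> \<delta>" by auto
    have "(log_power a b t)\<^sup>2 = t powr (2 * a) * \<bar>ln t\<bar> ^ (2 * b)"
      using t(1) by (rule log_power_square)
    also have "\<dots> \<le> t powr (2 * a) * (L * ((1 + 1 / \<delta>\<^sup>2) * t))"
    proof (intro mult_left_mono)
      have "1 / t = t / t\<^sup>2" using t by (simp add: power2_eq_square)
      also have "\<dots> \<le> t / \<delta>\<^sup>2" using t \<delta> by (intro divide_left_mono power_mono) auto
      finally have "max t (1 / t) \<le> (1 + 1 / \<delta>\<^sup>2) * t" using t \<delta> by (auto simp: algebra_simps)
      then show "\<bar>ln t\<bar> ^ (2 * b) \<le> L * ((1 + 1 / \<delta>\<^sup>2) * t)"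
        using t L by (intro order_trans[OF L(2)[OF t(1)]] mult_left_mono) auto
    qed simp
    finally have *: "(log_power a b t)\<^sup>2 \<le> t powr (2 * a) * (L * ((1 + 1 / \<delta>\<^sup>2) * t))" .
    have "(?v t)\<^sup>2 \<le> (t powr (2 * a) * (L * ((1 + 1 / \<delta>\<^sup>2) * t))) * (t powr - m)\<^sup>2"
      using * by (intro log_power_minus_damped_square_le) auto
    also have "\<dots> = L * (1 + 1 / \<delta>\<^sup>2) * (t powr (2 * a) * t powr 1 * (t powr - m * t powr - m))"
      using t by (simp add: power2_eq_square)
    also have "\<dots> = L * (1 + 1 / \<delta>\<^sup>2) * t powr \<kappa>"
      unfolding powr_add[symmetric] \<kappa>_def by (simp add: algebra_simps)
    also have "\<dots> \<le> L * (1 + 1 / \<delta>\<^sup>2) * (\<delta> / e) powr \<kappa>"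
      using L \<delta> e \<kappa> te by (intro mult_left_mono powr_mono2') auto
    also have "\<dots> = D * e powr - \<kappa>"
      using \<delta> e by (simp add: D_def powr_divide powr_minus_divide)
    also have "\<dots> \<le> D * e powr (\<rho> + 1)"
      using e \<kappa> L \<delta> by (intro mult_left_mono powr_mono') (auto simp: D_def)
    finally show "(?v t)\<^sup>2 \<le> D * e powr (\<rho> + 1)" .
  qed (use L \<delta> in \<open>auto simp: D_def intro!: mult_pos_pos add_pos_pos\<close>)
qed

section \<open>Integrals of scaled profiles against the weight\<close>

lemma AE_jacobi_measure_neq: "AE x in jacobi_measure \<alpha> \<beta>. x \<noteq> z"
proof -
  have "AE x in lborel. x \<in> {-1..1} \<longrightarrow> x \<noteq> z"
    using AE_lborel_singleton[of z] by eventually_elim simp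
  then have *: "AE x in restrict_space lborel {-1..1}. x \<noteq> z"
    by (subst AE_restrict_space_iff) auto
  have [measurable]: "jacobi_weight \<alpha> \<beta> \<in> borel_measurable (restrict_space lborel {-1..1})"
    by (rule measurable_restrict_space1) simp
  show ?thesis
    unfolding jacobi_measure_def using * by (subst AE_density) (auto elim: eventually_mono)
qed

lemma integral_scaled_tail_majorant:
  assumes "\<theta> > -1" "\<bar>s\<bar> = 1" "e > 0"
  shows "integrable lborel (\<lambda>x. tail_majorant \<theta> (s * (x - z) / e))"
    and "(\<integral>x. tail_majorant \<theta> (s * (x - z) / e) \<partial>lborel) = e * (\<integral>t. tail_majorant \<theta> t \<partial>lborel)"
proof -
  have eq: "(\<lambda>x. tail_majorant \<theta> (s * (x - z) / e)) = (\<lambda>x. tail_majorant \<theta> (- (s * z / e) + (s / e) * x))"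
    by (simp add: algebra_simps diff_divide_distrib)
  have c: "s / e \<noteq> 0" using assms by auto
  show "integrable lborel (\<lambda>x. tail_majorant \<theta> (s * (x - z) / e))"
    unfolding eq by (rule lborel_integrable_real_affine[OF integrable_tail_majorant[OF assms(1)] c])
  show "(\<integral>x. tail_majorant \<theta> (s * (x - z) / e) \<partial>lborel) = e * (\<integral>t. tail_majorant \<theta> t \<partial>lborel)"
    unfolding eq using lborel_integral_real_affine[OF c, of "tail_majorant \<theta>" "- (s * z / e)"] assms
    by simp
qed

text \<open>The power \<open>\<rho> + 1\<close> arises in two ways: in the first summand the
  integral of the scaled majorant supplies one factor \<open>e\<close>, and in the second the power
  stands before the finite mass of the weight.\<close>

lemma jacobi_integral_tail_majorant:
  fixes h :: "real \<Rightarrow> real"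
  assumes ab: "\<alpha> > -1" "\<beta> > -1" and \<theta>: "\<theta> > -1" and s: "\<bar>s\<bar> = 1" and e: "e > 0" and K: "K \<ge> 0"
    and h: "h \<in> borel_measurable (jacobi_measure \<alpha> \<beta>)" "\<And>x. x \<in> {-1..1} \<Longrightarrow> 0 \<le> h x"
    and bound: "\<And>x. x \<in> {-1..1} \<Longrightarrow> jacobi_weight \<alpha> \<beta> x * h x \<le>
      K * e powr \<rho> * tail_majorant \<theta> (s * (x - z) / e) + K * e powr (\<rho> + 1) * jacobi_weight \<alpha> \<beta> x"
  shows "integrable (jacobi_measure \<alpha> \<beta>) h"
    and "(\<integral>x. h x \<partial>jacobi_measure \<alpha> \<beta>) \<le> K * ((\<integral>t. tail_majorant \<theta> t \<partial>lborel) +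
      (LINT x:{-1..1}|lborel. jacobi_weight \<alpha> \<beta> x)) * e powr (\<rho> + 1)"
proof -
  let ?T = "\<lambda>x. tail_majorant \<theta> (s * (x - z) / e)" and ?w = "jacobi_weight \<alpha> \<beta>"
  let ?H = "\<lambda>x. K * e powr \<rho> * ?T x + K * e powr (\<rho> + 1) * (indicator {-1..1} x *\<^sub>R ?w x)"
  have w: "integrable lborel (\<lambda>x. indicator {-1..1} x *\<^sub>R ?w x)"
    using set_integrable_jacobi_weight[OF ab] by (simp only: set_integrable_def)
  have H: "integrable lborel ?H"
    using w integral_scaled_tail_majorant(1)[OF \<theta> s e]
    by (intro Bochner_Integration.integrable_add integrable_mult_right)
  have le: "indicator {-1..1} x *\<^sub>R (?w x * h x) \<le> ?H x"
    and nn: "0 \<le> indicator {-1..1} x *\<^sub>R (?w x * h x)" for x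
    using bound[of x] h(2)[of x] K by (auto simp: indicator_def jacobi_weight_nonneg)
  have hm: "h \<in> borel_measurable (restrict_space lborel {-1..1})"
    using h(1) unfolding borel_measurable_jacobi_measure
    by (simp add: measurable_cong_sets[OF sets_restrict_space_cong[OF sets_lborel] refl])
  have "(\<lambda>x. indicator {-1..1} x *\<^sub>R h x) \<in> borel_measurable lborel"
    using hm by (subst (asm) borel_measurable_restrict_space_iff) auto
  then have "(\<lambda>x. ?w x * (indicator {-1..1} x *\<^sub>R h x)) \<in> borel_measurable lborel"
    by measurable
  then have meas: "(\<lambda>x. indicator {-1..1} x *\<^sub>R (?w x * h x)) \<in> borel_measurable lborel"
    by (simp add: mult_ac)
  have I: "integrable lborel (\<lambda>x. indicator {-1..1} x *\<^sub>R (?w x * h x))"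
  proof (rule Bochner_Integration.integrable_bound[OF H meas], rule AE_I2)
    show "norm (indicator {-1..1} x *\<^sub>R (?w x * h x)) \<le> norm (?H x)" for x
      using le[of x] nn[of x] unfolding real_norm_def by linarith
  qed
  then show "integrable (jacobi_measure \<alpha> \<beta>) h"
    by (subst integrable_jacobi_measure[OF h(1)]) (simp only: set_integrable_def)
  have "(\<integral>x. h x \<partial>jacobi_measure \<alpha> \<beta>) = (\<integral>x. indicator {-1..1} x *\<^sub>R (?w x * h x) \<partial>lborel)"
    by (simp only: integral_jacobi_measure[OF h(1)] set_lebesgue_integral_def)
  also have "\<dots> \<le> (\<integral>x. ?H x \<partial>lborel)"
    by (intro integral_mono I H le)
  also have "\<dots> = K * e powr \<rho> * (\<integral>x. ?T x \<partial>lborel) +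
      K * e powr (\<rho> + 1) * (\<integral>x. indicator {-1..1} x *\<^sub>R ?w x \<partial>lborel)"
    using w integral_scaled_tail_majorant(1)[OF \<theta> s e] by simp
  also have "\<dots> = K * ((\<integral>t. tail_majorant \<theta> t \<partial>lborel) +
      (LINT x:{-1..1}|lborel. ?w x)) * e powr (\<rho> + 1)"
    unfolding integral_scaled_tail_majorant(2)[OF \<theta> s e] set_lebesgue_integral_def
    using e by (simp add: powr_add algebra_simps)
  finally show "(\<integral>x. h x \<partial>jacobi_measure \<alpha> \<beta>) \<le> K * ((\<integral>t. tail_majorant \<theta> t \<partial>lborel) +
      (LINT x:{-1..1}|lborel. jacobi_weight \<alpha> \<beta> x)) * e powr (\<rho> + 1)" .
qed

section \<open>Errors of damped and of smooth functions\<close>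

lemma C_infinity_on_bounded:
  assumes "C_infinity_on g {-1..1}"
  obtains B where "B > 0" "\<And>x. x \<in> {-1..1} \<Longrightarrow> (g x)\<^sup>2 \<le> B"
proof -
  have "continuous_on {-1..1} (\<lambda>x. (g x)\<^sup>2)"
    by (intro continuous_intros C_infinity_on_imp_continuous_on[OF assms])
  then have "bounded ((\<lambda>x. (g x)\<^sup>2) ` {-1..1})"
    by (intro compact_imp_bounded compact_continuous_image) auto
  then obtain B where "\<forall>x\<in>{-1..1}. (g x)\<^sup>2 \<le> B"
    unfolding bounded_iff by auto
  then show thesis by (intro that[of "max 1 B"]) (auto intro: max.coboundedI2)
qed

lemma C_infinity_on_interior_derivative:
  assumes "\<And>x. x \<in> {-1..1} \<Longrightarrow> (g has_real_derivative g' x) (at x within {-1..1})"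
    and "x \<in> {-1<..<1}"
  shows "(g has_real_derivative g' x) (at x)"
  using assms(1)[of x] assms(2) by (simp add: at_within_Icc_at)

lemma continuous_on_damped_scaled:
  assumes "m > 0"
  shows "continuous_on S (\<lambda>x. damped m a b (s * (x - z) / e))"
proof -
  have "continuous_on S (\<lambda>x. s * (x - z) * inverse e)" by (intro continuous_intros)
  then show ?thesis
    using continuous_on_compose2[OF continuous_on_damped[OF assms, of a b]] by (simp add: divide_inverse)
qed

text \<open>Each derivative gains N^-2 by \<open>jacobi_err_derivative\<close> and loses e^-2 by the
  chain rule. After the last one the error is bounded by the full norm, which the hypothesis on
  \<open>a - real r\<close> controls uniformly in \<open>e\<close>.\<close>

lemma damped_err_bound:
  assumes m: "m > 0" and s: "\<bar>s\<bar> = 1"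
  shows "\<alpha> > -1 \<Longrightarrow> \<beta> > -1 \<Longrightarrow> C_infinity_on g {-1..1} \<Longrightarrow> 2 * (a - real r) + \<rho> \<le> -3 \<Longrightarrow> W \<ge> 0 \<Longrightarrow>
    (\<And>x. x \<in> {-1..1} \<Longrightarrow> s * (x - z) > 0 \<Longrightarrow>
      jacobi_weight (\<alpha> + real r) (\<beta> + real r) x \<le> W * (s * (x - z)) powr \<rho>) \<Longrightarrow>
    \<exists>C\<ge>0. \<forall>N. \<forall>e. 0 < e \<and> e \<le> 1 \<longrightarrow>
      jacobi_err \<alpha> \<beta> (\<lambda>x. damped m a b (s * (x - z) / e) * g x) (N + r)
        \<le> C / (real N + 1) ^ (2 * r) * e powr (\<rho> + 1 - 2 * real r)"
proof (induction r arbitrary: \<alpha> \<beta> a b g)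
  case 0
  interpret orthogonal_system "jacobi_measure \<alpha> \<beta>" "jacobi_poly \<alpha> \<beta>"
    by (rule orthogonal_system_jacobi[OF 0(1,2)])
  obtain B where B: "B > 0" "\<And>x. x \<in> {-1..1} \<Longrightarrow> (g x)\<^sup>2 \<le> B"
    by (rule C_infinity_on_bounded[OF 0(3)]) (rule that)
  have "2 * a + \<rho> \<le> -3" using 0(4) by simp
  \<comment> \<open>The damped profile admits any exponent of the majorant at \<open>0\<close>;
    \<open>0\<close> is the simplest integrable one.\<close>
  then obtain C where C: "C > 0" "\<And>t. t > 0 \<Longrightarrow> (damped m a b t)\<^sup>2 * t powr \<rho> \<le> C * tail_majorant 0 t"
    by (rule damped_tail_majorant[OF m, of a \<rho> b 0]) (rule that)
  define K where "K = W * C * B"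
  have K: "K \<ge> 0" using B C 0(5) by (simp add: K_def)
  define D where "D = K * ((\<integral>t. tail_majorant 0 t \<partial>lborel) + (LINT x:{-1..1}|lborel. jacobi_weight \<alpha> \<beta> x))"
  have "D \<ge> 0"
    unfolding D_def using K integral_jacobi_weight_pos[OF 0(1,2)]
    by (intro mult_nonneg_nonneg add_nonneg_nonneg integral_nonneg_AE) auto
  moreover have "jacobi_err \<alpha> \<beta> (\<lambda>x. damped m a b (s * (x - z) / e) * g x) N \<le> D * e powr (\<rho> + 1)"
    if e: "0 < e" "e \<le> 1" for e N
  proof -
    let ?u = "\<lambda>x. damped m a b (s * (x - z) / e) * g x"
    have u: "continuous_on {-1..1} ?u"
      by (intro continuous_on_mult continuous_on_damped_scaled m C_infinity_on_imp_continuous_on[OF 0(3)])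
    have "err ?u N \<le> (\<integral>x. (?u x)\<^sup>2 \<partial>jacobi_measure \<alpha> \<beta>)"
      by (intro err_le_integral square_integrable_jacobi_continuous 0 u)
    also have "\<dots> \<le> D * e powr (\<rho> + 1)"
      unfolding D_def
    proof (rule jacobi_integral_tail_majorant(2)[OF 0(1,2) _ s e(1) K])
      show "(\<lambda>x. (?u x)\<^sup>2) \<in> borel_measurable (jacobi_measure \<alpha> \<beta>)"
        by (intro borel_measurable_jacobi_measure_continuous continuous_on_power u)
      fix x :: real assume x: "x \<in> {-1..1}"
      let ?t = "s * (x - z) / e"
      show "jacobi_weight \<alpha> \<beta> x * (?u x)\<^sup>2 \<le>
        K * e powr \<rho> * tail_majorant 0 ?t + K * e powr (\<rho> + 1) * jacobi_weight \<alpha> \<beta> x"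
      proof (cases "s * (x - z) > 0")
        case True
        then have t: "?t > 0" using e by simp
        have "(e * ?t) powr \<rho> = e powr \<rho> * ?t powr \<rho>"
          by (rule powr_mult)
        moreover have "e * ?t = s * (x - z)" using e by simp
        ultimately have w: "jacobi_weight \<alpha> \<beta> x \<le> W * (e powr \<rho> * ?t powr \<rho>)"
          using 0(6)[OF x True] by simp
        have "jacobi_weight \<alpha> \<beta> x * (?u x)\<^sup>2 \<le> (W * (e powr \<rho> * ?t powr \<rho>)) * ((damped m a b ?t)\<^sup>2 * B)"
          unfolding power_mult_distrib using w B x 0(5)
          by (intro mult_mono mult_left_mono mult_nonneg_nonneg) auto
        also have "\<dots> = W * e powr \<rho> * B * ((damped m a b ?t)\<^sup>2 * ?t powr \<rho>)"
          by (simp only: mult_ac)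
        also have "\<dots> \<le> W * e powr \<rho> * B * (C * tail_majorant 0 ?t)"
          using C(2)[OF t] B 0(5) by (intro mult_left_mono) auto
        also have "\<dots> = K * e powr \<rho> * tail_majorant 0 ?t" by (simp only: K_def mult_ac)
        also have "\<dots> \<le> K * e powr \<rho> * tail_majorant 0 ?t + K * e powr (\<rho> + 1) * jacobi_weight \<alpha> \<beta> x"
          using K by (simp add: jacobi_weight_nonneg)
        finally show ?thesis .
      next
        case False
        then have "?t \<le> 0" using e by (simp add: divide_le_0_iff)
        then show ?thesis using K by (simp add: jacobi_weight_nonneg)
      qed
    qed auto
    finally show ?thesis .
  qed
  ultimately show ?case by (intro exI[of _ D]) auto
next
  case (Suc r)
  let ?\<alpha> = "\<alpha> + 1" and ?\<beta> = "\<beta> + 1"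
  have ab: "\<alpha> > -1" "\<beta> > -1" "?\<alpha> > -1" "?\<beta> > -1" using Suc.prems by auto
  interpret orthogonal_system "jacobi_measure ?\<alpha> ?\<beta>" "jacobi_poly ?\<alpha> ?\<beta>"
    by (rule orthogonal_system_jacobi[OF ab(3,4)])
  obtain g' where g': "C_infinity_on g' {-1..1}"
      "\<And>x. x \<in> {-1..1} \<Longrightarrow> (g has_real_derivative g' x) (at x within {-1..1})"
    by (rule C_infinity_on_derivative[OF Suc.prems(3)]) (rule that)
  \<comment> \<open>\<open>W\<close> and \<open>\<rho>\<close> describe the weight after all
    derivatives and pass through the induction unchanged; an exponent at most \<open>a - 1\<close>
    restores the hypothesis for \<open>r\<close>.\<close>
  have IH: "\<exists>C\<ge>0. \<forall>N. \<forall>e. 0 < e \<and> e \<le> 1 \<longrightarrow>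
      err (\<lambda>x. damped m a' b' (s * (x - z) / e) * h x) (N + r)
        \<le> C / (real N + 1) ^ (2 * r) * e powr (\<rho> + 1 - 2 * real r)"
    if "C_infinity_on h {-1..1}" "a' \<le> a - 1" for a' b' h
  proof (rule Suc.IH[OF ab(3,4) that(1) _ Suc.prems(5)])
    show "2 * (a' - real r) + \<rho> \<le> -3" using that(2) Suc.prems(4) by simp
    show "jacobi_weight (?\<alpha> + real r) (?\<beta> + real r) x \<le> W * (s * (x - z)) powr \<rho>"
      if "x \<in> {-1..1}" "s * (x - z) > 0" for x
      using Suc.prems(6)[OF that] by (simp add: add.assoc)
  qed
  let ?y = "\<lambda>x. s * (x - z)"
  \<comment> \<open>The inner derivative \<open>s\<close> and all scalars are put into the smooth
    factors, so that only \<open>1 / e\<close> remains outside.\<close>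
  let ?g1 = "\<lambda>x. s * a * g x" and ?g2 = "\<lambda>x. s * real b * g x" and ?g3 = "\<lambda>x. s * m * g x"
    and ?g4 = "\<lambda>x. s * (x - z) * g' x"
  have smooth: "C_infinity_on ?g1 {-1..1}" "C_infinity_on ?g2 {-1..1}" "C_infinity_on ?g3 {-1..1}"
      "C_infinity_on ?g4 {-1..1}"
    by (intro C_infinity_on_cmult C_infinity_on_linear_mult Suc.prems g')+
  have le: "a - 1 \<le> a - 1" "a - m - 1 \<le> a - 1" using m by auto
  let ?R = "\<lambda>C (N::nat) e. C / (real N + 1) ^ (2 * r) * e powr (\<rho> + 1 - 2 * real r)"
  obtain C1 where C1: "C1 \<ge> 0" "\<And>N e. 0 < e \<Longrightarrow> e \<le> 1 \<Longrightarrow>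
      err (\<lambda>x. damped m (a - 1) b (?y x / e) * ?g1 x) (N + r) \<le> ?R C1 N e"
    using IH[OF smooth(1) le(1), of b] by blast
  obtain C2 where C2: "C2 \<ge> 0" "\<And>N e. 0 < e \<Longrightarrow> e \<le> 1 \<Longrightarrow>
      err (\<lambda>x. damped m (a - 1) (b - 1) (?y x / e) * ?g2 x) (N + r) \<le> ?R C2 N e"
    using IH[OF smooth(2) le(1), of "b - 1"] by blast
  obtain C3 where C3: "C3 \<ge> 0" "\<And>N e. 0 < e \<Longrightarrow> e \<le> 1 \<Longrightarrow>
      err (\<lambda>x. damped m (a - m - 1) b (?y x / e) * ?g3 x) (N + r) \<le> ?R C3 N e"
    using IH[OF smooth(3) le(2), of b] by blast
  obtain C4 where C4: "C4 \<ge> 0" "\<And>N e. 0 < e \<Longrightarrow> e \<le> 1 \<Longrightarrow>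
      err (\<lambda>x. damped m (a - 1) b (?y x / e) * ?g4 x) (N + r) \<le> ?R C4 N e"
    using IH[OF smooth(4) le(1), of b] by blast
  define C where "C = 4 * (C1 + C2 + C3 + C4)"
  have "C \<ge> 0" using C1 C2 C3 C4 by (simp add: C_def)
  moreover have "jacobi_err \<alpha> \<beta> (\<lambda>x. damped m a b (?y x / e) * g x) (N + Suc r)
      \<le> C / (real N + 1) ^ (2 * Suc r) * e powr (\<rho> + 1 - 2 * real (Suc r))"
    if e: "0 < e" "e \<le> 1" for N e
  proof -
    let ?d1 = "\<lambda>x. damped m (a - 1) b (?y x / e) * ?g1 x"
    let ?d2 = "\<lambda>x. damped m (a - 1) (b - 1) (?y x / e) * ?g2 x"
    let ?d3 = "\<lambda>x. damped m (a - m - 1) b (?y x / e) * ?g3 x"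
    let ?d4 = "\<lambda>x. damped m (a - 1) b (?y x / e) * ?g4 x"
    let ?u' = "\<lambda>x. (?d1 x + ?d2 x) + (?d3 x + ?d4 x)"
    have cont: "continuous_on {-1..1} (\<lambda>x. damped m a' b' (?y x / e) * h x)"
      if "C_infinity_on h {-1..1}" for a' b' h
      by (intro continuous_on_mult continuous_on_damped_scaled m C_infinity_on_imp_continuous_on that)
    have c: "continuous_on {-1..1} ?d1" "continuous_on {-1..1} ?d2" "continuous_on {-1..1} ?d3"
        "continuous_on {-1..1} ?d4"
      by (intro cont smooth)+
    have u': "continuous_on {-1..1} (\<lambda>x. 1 / e * ?u' x)"
      by (intro continuous_on_mult continuous_on_add continuous_on_const c)
    have sq: "square_integrable (jacobi_measure ?\<alpha> ?\<beta>) h" if "continuous_on {-1..1} h" for h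
      by (rule square_integrable_jacobi_continuous[OF ab(3,4) that])
    have d: "((\<lambda>x. damped m a b (?y x / e) * g x) has_real_derivative 1 / e * ?u' x) (at x)"
      if x: "x \<in> {-1<..<1}" for x
    proof -
      have y: "((\<lambda>x. ?y x / e) has_real_derivative s / e) (at x)"
        using e by (auto intro!: derivative_eq_intros)
      let ?D = "a * damped m (a - 1) b (?y x / e) + real b * damped m (a - 1) (b - 1) (?y x / e)
        + m * damped m (a - m - 1) b (?y x / e)"
      have "((\<lambda>x. damped m a b (?y x / e) * g x) has_real_derivative
          ?D * (s / e) * g x + g' x * damped m a b (?y x / e)) (at x)"
        by (intro DERIV_mult C_infinity_on_interior_derivative[OF g'(2) x]
            DERIV_chain2[OF damped_has_derivative[OF m] y])
      also have "?D * (s / e) * g x + g' x * damped m a b (?y x / e) = 1 / e * ?u' x"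
        unfolding damped_eq_mult[of m a b] using e by (simp add: field_simps)
      finally show ?thesis .
    qed
    have arith: "x1 \<le> 2 * x2 + 2 * x3 \<Longrightarrow> x2 \<le> 2 * x4 + 2 * x5 \<Longrightarrow> x3 \<le> 2 * x6 + 2 * x7 \<Longrightarrow>
        x1 \<le> 4 * (x4 + x5 + x6 + x7)" for x1 x2 x3 x4 x5 x6 x7 :: real
      by simp
    have "jacobi_err \<alpha> \<beta> (\<lambda>x. damped m a b (?y x / e) * g x) (Suc (N + r))
        \<le> err (\<lambda>x. 1 / e * ?u' x) (N + r) / (real (Suc (N + r)))\<^sup>2"
      by (rule jacobi_err_derivative[OF ab(1,2) cont[OF Suc.prems(3)] u' d])
    also have "\<dots> = (1 / e)\<^sup>2 * err ?u' (N + r) / (real (Suc (N + r)))\<^sup>2"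
      by (simp only: err_cmult)
    also have "err ?u' (N + r) \<le> 4 * (err ?d1 (N + r) + err ?d2 (N + r) + err ?d3 (N + r) + err ?d4 (N + r))"
      by (rule arith[OF err_add[OF square_integrable_add[OF sq[OF c(1)] sq[OF c(2)]]
            square_integrable_add[OF sq[OF c(3)] sq[OF c(4)]]]
            err_add[OF sq[OF c(1)] sq[OF c(2)]] err_add[OF sq[OF c(3)] sq[OF c(4)]]])
    also have "\<dots> \<le> 4 * (?R C1 N e + ?R C2 N e + ?R C3 N e + ?R C4 N e)"
      by (intro mult_left_mono add_mono C1(2) C2(2) C3(2) C4(2) e) simp
    also have "\<dots> = ?R C N e"
      by (simp add: C_def add_divide_distrib distrib_right)
    also have "(1 / e)\<^sup>2 * ?R C N e / (real (Suc (N + r)))\<^sup>2 \<le> (1 / e)\<^sup>2 * ?R C N e / (real N + 1)\<^sup>2"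
      using \<open>C \<ge> 0\<close> by (intro divide_left_mono power_mono mult_pos_pos zero_less_power) auto
    also have "\<dots> = C / (real N + 1) ^ (2 * Suc r) * ((1 / e)\<^sup>2 * e powr (\<rho> + 1 - 2 * real r))"
      by (simp add: power2_eq_square)
    also have "(1 / e)\<^sup>2 * e powr (\<rho> + 1 - 2 * real r) = e powr (\<rho> + 1 - 2 * real (Suc r))"
    proof -
      have "(1 / e)\<^sup>2 = e powr -2" using e by (simp add: powr_minus_divide powr_numeral power_divide)
      then show ?thesis by (simp only: powr_add[symmetric]) (simp add: algebra_simps)
    qed
    finally show ?thesis
      by (simp add: divide_right_mono mult_left_mono)
  qed
  ultimately show ?case by blast
qed

text \<open>Since \<open>r\<close> is arbitrary, the decay beats any power; this absorbs the surplus
  logarithms in \<open>err_log_power_nat\<close>.\<close>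

lemma smooth_err_bound:
  "\<alpha> > -1 \<Longrightarrow> \<beta> > -1 \<Longrightarrow> C_infinity_on g {-1..1} \<Longrightarrow>
    \<exists>C\<ge>0. \<forall>N. jacobi_err \<alpha> \<beta> g (N + r) \<le> C / (real N + 1) ^ (2 * r)"
proof (induction r arbitrary: \<alpha> \<beta> g)
  case 0
  interpret orthogonal_system "jacobi_measure \<alpha> \<beta>" "jacobi_poly \<alpha> \<beta>"
    by (rule orthogonal_system_jacobi[OF 0(1,2)])
  show ?case
    by (intro exI[of _ "\<integral>x. (g x)\<^sup>2 \<partial>jacobi_measure \<alpha> \<beta>"])
      (auto intro!: err_le_integral square_integrable_jacobi_continuous 0 C_infinity_on_imp_continuous_on)
next
  case (Suc r)
  obtain g' where g': "C_infinity_on g' {-1..1}"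
      "\<And>x. x \<in> {-1..1} \<Longrightarrow> (g has_real_derivative g' x) (at x within {-1..1})"
    by (rule C_infinity_on_derivative[OF Suc.prems(3)]) (rule that)
  have "\<exists>C\<ge>0. \<forall>N. jacobi_err (\<alpha> + 1) (\<beta> + 1) g' (N + r) \<le> C / (real N + 1) ^ (2 * r)"
    using Suc.prems g' by (intro Suc.IH) auto
  then obtain C where C: "C \<ge> 0"
      "\<And>N. jacobi_err (\<alpha> + 1) (\<beta> + 1) g' (N + r) \<le> C / (real N + 1) ^ (2 * r)"
    by blast
  have "jacobi_err \<alpha> \<beta> g (N + Suc r) \<le> C / (real N + 1) ^ (2 * Suc r)" for N
  proof -
    have "jacobi_err \<alpha> \<beta> g (Suc (N + r)) \<le> jacobi_err (\<alpha> + 1) (\<beta> + 1) g' (N + r) / (real (Suc (N + r)))\<^sup>2"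
      using Suc.prems g'
      by (intro jacobi_err_derivative C_infinity_on_imp_continuous_on C_infinity_on_interior_derivative) auto
    also have "\<dots> \<le> (C / (real N + 1) ^ (2 * r)) / (real N + 1)\<^sup>2"
      using C by (intro frac_le power_mono) auto
    also have "\<dots> = C / (real N + 1) ^ (2 * Suc r)"
      by (simp add: power2_eq_square mult_ac)
    finally show ?thesis by simp
  qed
  with C(1) show ?case by blast
qed

section \<open>One-sided singularities\<close>

text \<open>
  The singularity sits at \<open>z\<close> and is approached from the side where \<open>s * (x - z) > 0\<close>. Each derivative
  step multiplies the weight by \<open>1 - x\<^sup>2\<close>, which improves its order at \<open>z\<close> by \<open>\<kappa>\<close>: by \<open>1\<close> at an end
  point of the interval and by \<open>0\<close> inside. The scale \<open>n powr - q\<close> balances the gain \<open>n powr - 2\<close>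
  in the squared error against the loss \<open>(n powr - q) powr (\<kappa> - 2)\<close> per step.
\<close>

locale jacobi_one_sided =
  fixes \<alpha> \<beta> s z \<rho> \<kappa> q :: real
  assumes ab: "\<alpha> > -1" "\<beta> > -1" and s: "\<bar>s\<bar> = 1" and \<rho>: "\<rho> > -1"
    and \<kappa>: "\<kappa> \<le> 1" and q: "q > 0" "q * (2 - \<kappa>) = 2"
    and weight_near: "\<exists>W\<ge>0. \<exists>\<delta>>0. \<forall>x\<in>{-1..1}. 0 < s * (x - z) \<and> s * (x - z) \<le> \<delta> \<longrightarrow>
      jacobi_weight \<alpha> \<beta> x \<le> W * (s * (x - z)) powr \<rho>"
    and weight_shift: "\<And>r. - \<alpha> \<le> real r \<Longrightarrow> - \<beta> \<le> real r \<Longrightarrow> \<exists>W\<ge>0. \<forall>x\<in>{-1..1}. 0 < s * (x - z) \<longrightarrow>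
      jacobi_weight (\<alpha> + real r) (\<beta> + real r) x \<le> W * (s * (x - z)) powr (\<rho> + \<kappa> * real r)"
begin

sublocale orthogonal_system "jacobi_measure \<alpha> \<beta>" "jacobi_poly \<alpha> \<beta>"
  by (rule orthogonal_system_jacobi[OF ab])

abbreviation "M \<equiv> jacobi_measure \<alpha> \<beta>"

abbreviation "y x \<equiv> s * (x - z)"

text \<open>Three zones: the wrong side, where the function vanishes; the vicinity of
  \<open>z\<close>, where the weight is compared with a power; and the far zone, where only the
  weight's integral is available. Square integrability is part of the conclusion because the
  function may be unbounded at \<open>z\<close>.\<close>

lemma remainder_bound:
  assumes g: "C_infinity_on g {-1..1}" and a: "2 * a + \<rho> > -1" and m: "2 * a + \<rho> - 2 * m \<le> -3"
  shows "\<exists>C\<ge>0. \<forall>e. 0 < e \<and> e \<le> 1 \<longrightarrow>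
    square_integrable M (\<lambda>x. (log_power a b (y x / e) - damped m a b (y x / e)) * g x) \<and>
    (\<integral>x. ((log_power a b (y x / e) - damped m a b (y x / e)) * g x)\<^sup>2 \<partial>M) \<le> C * e powr (\<rho> + 1)"
proof -
  let ?\<theta> = "(2 * a + \<rho> - 1) / 2"
  let ?v = "\<lambda>t. log_power a b t - damped m a b t"
  have \<theta>: "?\<theta> > -1" using a by simp
  obtain W \<delta> where W: "W \<ge> 0" "\<delta> > 0" "\<And>x. x \<in> {-1..1} \<Longrightarrow> 0 < y x \<Longrightarrow> y x \<le> \<delta> \<Longrightarrow>
      jacobi_weight \<alpha> \<beta> x \<le> W * y x powr \<rho>"
    using weight_near by blast
  obtain B where B: "B > 0" "\<And>x. x \<in> {-1..1} \<Longrightarrow> (g x)\<^sup>2 \<le> B"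
    by (rule C_infinity_on_bounded[OF g]) (rule that)
  obtain C where C: "C > 0" "\<And>t. t > 0 \<Longrightarrow> (?v t)\<^sup>2 * t powr \<rho> \<le> C * tail_majorant ?\<theta> t"
    by (rule log_power_minus_damped_tail_majorant[OF a m, of b]) (rule that)
  obtain D where D: "D > 0" "\<And>t e. 0 < e \<Longrightarrow> e \<le> 1 \<Longrightarrow> t > \<delta> / e \<Longrightarrow> (?v t)\<^sup>2 \<le> D * e powr (\<rho> + 1)"
    by (rule log_power_minus_damped_far[OF \<rho> m W(2), of b]) (rule that)
  define K where "K = W * C * B + D * B"
  have K: "K \<ge> 0" using B C D W by (simp add: K_def)
  define L where "L = K * ((\<integral>t. tail_majorant ?\<theta> t \<partial>lborel) + (LINT x:{-1..1}|lborel. jacobi_weight \<alpha> \<beta> x))"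
  have "L \<ge> 0"
    unfolding L_def using K integral_jacobi_weight_pos[OF ab]
    by (intro mult_nonneg_nonneg add_nonneg_nonneg integral_nonneg_AE) auto
  moreover have "square_integrable M (\<lambda>x. ?v (y x / e) * g x) \<and>
      (\<integral>x. (?v (y x / e) * g x)\<^sup>2 \<partial>M) \<le> L * e powr (\<rho> + 1)"
    if e: "0 < e" "e \<le> 1" for e
  proof -
    let ?u = "\<lambda>x. ?v (y x / e) * g x"
    have "(\<lambda>x. ?v (y x / e)) \<in> borel_measurable borel" by measurable
    then have u: "?u \<in> borel_measurable M"
      by (intro borel_measurable_times borel_measurable_jacobi_measure_borel
          borel_measurable_jacobi_measure_continuous C_infinity_on_imp_continuous_on[OF g])
    have "jacobi_weight \<alpha> \<beta> x * (?u x)\<^sup>2 \<le>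
        K * e powr \<rho> * tail_majorant ?\<theta> (y x / e) + K * e powr (\<rho> + 1) * jacobi_weight \<alpha> \<beta> x"
      if x: "x \<in> {-1..1}" for x
    proof -
      let ?t = "y x / e"
      have nn: "0 \<le> e powr \<rho> * tail_majorant ?\<theta> ?t" "0 \<le> e powr (\<rho> + 1) * jacobi_weight \<alpha> \<beta> x"
        by (simp_all add: jacobi_weight_nonneg)
      have WCB: "0 \<le> W * C * B" and DB: "0 \<le> D * B" using W B C D by auto
      consider "y x \<le> 0" | "0 < y x" "y x \<le> \<delta>" | "y x > \<delta>" by linarith
      then show ?thesis
      proof cases
        case 1
        then have "?t \<le> 0" using e by (simp add: divide_le_0_iff)
        then show ?thesis using K by (simp add: jacobi_weight_nonneg)
      next
        case 2
        then have t: "?t > 0" using e by simp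
        have "(e * ?t) powr \<rho> = e powr \<rho> * ?t powr \<rho>" by (rule powr_mult)
        moreover have "e * ?t = y x" using e by simp
        ultimately have w: "jacobi_weight \<alpha> \<beta> x \<le> W * (e powr \<rho> * ?t powr \<rho>)"
          using W(3)[OF x 2] by simp
        have "jacobi_weight \<alpha> \<beta> x * (?u x)\<^sup>2 \<le> (W * (e powr \<rho> * ?t powr \<rho>)) * ((?v ?t)\<^sup>2 * B)"
          unfolding power_mult_distrib using w B x W(1)
          by (intro mult_mono mult_left_mono mult_nonneg_nonneg) auto
        also have "\<dots> = W * e powr \<rho> * B * ((?v ?t)\<^sup>2 * ?t powr \<rho>)"
          by (simp only: mult_ac)
        also have "\<dots> \<le> W * e powr \<rho> * B * (C * tail_majorant ?\<theta> ?t)"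
          using C(2)[OF t] B W(1) by (intro mult_left_mono) auto
        also have "\<dots> = W * C * B * (e powr \<rho> * tail_majorant ?\<theta> ?t)" by (simp only: mult_ac)
        also have "\<dots> \<le> K * (e powr \<rho> * tail_majorant ?\<theta> ?t) + K * (e powr (\<rho> + 1) * jacobi_weight \<alpha> \<beta> x)"
          using mult_nonneg_nonneg[OF DB nn(1)] mult_nonneg_nonneg[OF K nn(2)]
          unfolding K_def distrib_right by linarith
        finally show ?thesis by (simp only: mult.assoc)
      next
        case 3
        then have t: "?t > \<delta> / e" using e by (simp add: divide_strict_right_mono)
        have "jacobi_weight \<alpha> \<beta> x * (?u x)\<^sup>2 \<le> jacobi_weight \<alpha> \<beta> x * ((D * e powr (\<rho> + 1)) * B)"
          unfolding power_mult_distrib using D(2)[OF e t] B x D(1)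
          by (intro mult_mono mult_left_mono mult_nonneg_nonneg) (auto simp: jacobi_weight_nonneg)
        also have "\<dots> = D * B * (e powr (\<rho> + 1) * jacobi_weight \<alpha> \<beta> x)" by (simp only: mult_ac)
        also have "\<dots> \<le> K * (e powr \<rho> * tail_majorant ?\<theta> ?t) + K * (e powr (\<rho> + 1) * jacobi_weight \<alpha> \<beta> x)"
          using mult_nonneg_nonneg[OF WCB nn(2)] mult_nonneg_nonneg[OF K nn(1)]
          unfolding K_def distrib_right by linarith
        finally show ?thesis by (simp only: mult.assoc)
      qed
    qed
    note bound = jacobi_integral_tail_majorant[OF ab \<theta> s e(1) K _ _ this]
    have "(\<lambda>x. (?u x)\<^sup>2) \<in> borel_measurable M" using u by (rule borel_measurable_power)
    then have "integrable M (\<lambda>x. (?u x)\<^sup>2)" "(\<integral>x. (?u x)\<^sup>2 \<partial>M) \<le> L * e powr (\<rho> + 1)"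
      unfolding L_def by (rule bound; simp)+
    with u show ?thesis by (simp add: square_integrable_def)
  qed
  ultimately show ?thesis by (intro exI[of _ L]) simp
qed

lemma square_integrable_damped:
  assumes "C_infinity_on g {-1..1}" "m > 0"
  shows "square_integrable M (\<lambda>x. damped m a b (y x / e) * g x)"
  using assms by (intro square_integrable_jacobi_continuous ab continuous_on_mult
      continuous_on_damped_scaled C_infinity_on_imp_continuous_on)

lemma square_integrable_log_power:
  assumes g: "C_infinity_on g {-1..1}" and a: "2 * a + \<rho> > -1" and e: "0 < e" "e \<le> 1"
  shows "square_integrable M (\<lambda>x. log_power a b (y x / e) * g x)"
proof -
  \<comment> \<open>Gives \<open>2 * a + \<rho> - 2 * m = -5\<close>, and \<open>m\<close> is
    positive because \<open>2 * a + \<rho> > -1\<close>.\<close>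
  define m where "m = 1 + (2 * a + \<rho> + 3) / 2"
  have m: "m > 0" "2 * a + \<rho> - 2 * m \<le> -3" using a by (auto simp: m_def field_simps)
  have "square_integrable M (\<lambda>x. (log_power a b (y x / e) - damped m a b (y x / e)) * g x)"
    using remainder_bound[OF g a m(2)] e by blast
  from square_integrable_add[OF this square_integrable_damped[OF g m(1), of a b e]]
  show ?thesis by (simp add: algebra_simps)
qed

text \<open>The bounds for \<open>N + r\<close> are in powers of \<open>N + 1\<close>. At
  \<open>N + r = n\<close> they become powers of \<open>n\<close>, since (r + 1)(n - r + 1) = n + r
  (n - r) + 1 >= n.\<close>

lemma shifted_index_bound:
  assumes "r \<le> n"
  shows "1 / (real (n - r) + 1) ^ (2 * r) \<le> (real r + 1) ^ (2 * r) / real n ^ (2 * r)"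
proof (cases "n = 0")
  case False
  have "(real r + 1) * (real (n - r) + 1) = real n + (real r * (real n - real r) + 1)"
    using assms by (simp add: of_nat_diff algebra_simps)
  moreover have "0 \<le> real r * (real n - real r)" using assms by (intro mult_nonneg_nonneg) auto
  ultimately have "real n \<le> (real r + 1) * (real (n - r) + 1)" by linarith
  then have "real n ^ (2 * r) \<le> ((real r + 1) * (real (n - r) + 1)) ^ (2 * r)" by (intro power_mono) auto
  then show ?thesis
    using False by (simp add: power_mult_distrib divide_le_eq pos_divide_le_eq mult.commute)
qed (use assms in simp)

lemma powr_minus_q_le_1: "n \<ge> 1 \<Longrightarrow> 0 < real n powr - q \<and> real n powr - q \<le> 1"
  using q by (auto intro!: powr_le_one_le simp: powr_minus_divide ge_one_powr_ge_zero)

lemma err_log_power_scaled: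
  assumes g: "C_infinity_on g {-1..1}" and a: "2 * a + \<rho> > -1"
  shows "\<exists>C\<ge>0. \<forall>\<^sub>F n in sequentially.
    err (\<lambda>x. log_power a b (y x / real n powr - q) * g x) n \<le> C * (real n powr - q) powr (\<rho> + 1)"
proof -
  define m where "m = 1 + (2 * a + \<rho> + 3) / 2"
  have m: "m > 0" "2 * a + \<rho> - 2 * m \<le> -3" using a by (auto simp: m_def field_simps)
  obtain C1 where C1: "C1 \<ge> 0" "\<And>e. 0 < e \<and> e \<le> 1 \<Longrightarrow>
      square_integrable M (\<lambda>x. (log_power a b (y x / e) - damped m a b (y x / e)) * g x) \<and>
      (\<integral>x. ((log_power a b (y x / e) - damped m a b (y x / e)) * g x)\<^sup>2 \<partial>M) \<le> C1 * e powr (\<rho> + 1)"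
    using remainder_bound[OF g a m(2), of b] by blast
  \<comment> \<open>The first two bounds make both exponents of the shifted weight nonnegative, so
    that it is controlled on the whole interval. With \<open>\<kappa> \<le> 1\<close> the last one
    gives 2 (a - r) + rho + kappa r <= 2 a + rho - r <= -3.\<close>
  obtain r :: nat where r: "real r \<ge> max (max (- \<alpha>) (- \<beta>)) (2 * a + \<rho> + 3)"
    using real_arch_simple by blast
  obtain W where W: "W \<ge> 0" "\<And>x. x \<in> {-1..1} \<Longrightarrow> 0 < y x \<Longrightarrow>
      jacobi_weight (\<alpha> + real r) (\<beta> + real r) x \<le> W * y x powr (\<rho> + \<kappa> * real r)"
    using weight_shift[of r] r by auto
  have "\<kappa> * real r \<le> 1 * real r" using \<kappa> by (intro mult_right_mono) auto
  then have "2 * (a - real r) + (\<rho> + \<kappa> * real r) \<le> -3" using r by simp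
  from damped_err_bound[OF m(1) s ab g this W]
  obtain C2 where C2: "C2 \<ge> 0" "\<And>N e. 0 < e \<and> e \<le> 1 \<Longrightarrow>
      err (\<lambda>x. damped m a b (y x / e) * g x) (N + r)
        \<le> C2 / (real N + 1) ^ (2 * r) * e powr (\<rho> + \<kappa> * real r + 1 - 2 * real r)"
    by blast
  define C where "C = 2 * C1 + 2 * (C2 * (real r + 1) ^ (2 * r))"
  have "err (\<lambda>x. log_power a b (y x / real n powr - q) * g x) n \<le> C * (real n powr - q) powr (\<rho> + 1)"
    if n: "n \<ge> max 1 r" for n
  proof -
    define e where "e = real n powr - q"
    have e: "0 < e \<and> e \<le> 1" unfolding e_def using n by (intro powr_minus_q_le_1) simp
    let ?v = "\<lambda>x. (log_power a b (y x / e) - damped m a b (y x / e)) * g x"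
    let ?d = "\<lambda>x. damped m a b (y x / e) * g x"
    have v: "square_integrable M ?v" using C1(2)[OF e] by blast
    have "err (\<lambda>x. log_power a b (y x / e) * g x) n = err (\<lambda>x. ?v x + ?d x) n"
      by (simp add: algebra_simps)
    also have "\<dots> \<le> 2 * err ?v n + 2 * err ?d n"
      by (intro err_add v square_integrable_damped g m)
    also have "err ?v n \<le> C1 * e powr (\<rho> + 1)"
      using C1(2)[OF e] err_le_integral[OF v] by (blast intro: order_trans)
    also have "err ?d n \<le> C2 * (real r + 1) ^ (2 * r) * e powr (\<rho> + 1)"
    proof -
      have "err ?d n \<le> C2 * (1 / (real (n - r) + 1) ^ (2 * r)) * e powr (\<rho> + \<kappa> * real r + 1 - 2 * real r)"
        using C2(2)[OF e, of "n - r"] n by simp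
      also have "\<dots> \<le> C2 * ((real r + 1) ^ (2 * r) / real n ^ (2 * r)) * e powr (\<rho> + \<kappa> * real r + 1 - 2 * real r)"
        using n C2(1) by (intro mult_right_mono mult_left_mono shifted_index_bound) auto
      \<comment> \<open>The relation \<open>q * (2 - \<kappa>) = 2\<close> makes the loss of the
        \<open>r\<close> steps exactly the power of \<open>n\<close> in the denominator.\<close>
      also have "e powr (\<rho> + \<kappa> * real r + 1 - 2 * real r) = e powr (\<rho> + 1) * real n ^ (2 * r)"
      proof -
        have "e powr (\<rho> + \<kappa> * real r + 1 - 2 * real r) = e powr (\<rho> + 1) * e powr (\<kappa> * real r - 2 * real r)"
          by (simp only: powr_add[symmetric]) (simp add: algebra_simps)
        moreover have "e powr (\<kappa> * real r - 2 * real r) = real n powr (real r * (q * (2 - \<kappa>)))"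
          unfolding e_def powr_powr by (simp add: algebra_simps)
        moreover have "real n powr (real r * (q * (2 - \<kappa>))) = real n ^ (2 * r)"
          unfolding q(2) using n by (simp flip: powr_realpow add: mult.commute)
        ultimately show ?thesis by simp
      qed
      also have "C2 * ((real r + 1) ^ (2 * r) / real n ^ (2 * r)) * (e powr (\<rho> + 1) * real n ^ (2 * r))
          = C2 * (real r + 1) ^ (2 * r) * e powr (\<rho> + 1)"
        using n by simp
      finally show ?thesis .
    qed
    finally show ?thesis unfolding e_def[symmetric] by (simp add: C_def algebra_simps)
  qed
  moreover have "C \<ge> 0" using C1 C2 by (simp add: C_def)
  ultimately show ?thesis
    by (intro exI[of _ C] conjI eventually_sequentiallyI[of "max 1 r"]) auto
qed

section \<open>Summation over the powers of the logarithm\<close>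

lemma log_power_rescale:
  assumes "e > 0"
  shows "log_power a n t = (\<Sum>j\<le>n. real (n choose j) * ln e ^ (n - j) * e powr a * log_power a j (t / e))"
proof (cases "t > 0")
  case True
  have "t powr a = e powr a * (t / e) powr a"
    using powr_mult[of e "t / e" a] assms by simp
  moreover have "ln t = ln (t / e) + ln e" using True assms by (simp add: ln_div)
  ultimately show ?thesis
    using True assms by (simp only: log_power_def binomial_ring sum_distrib_left) (simp add: mult_ac)
next
  case False
  then have "t / e \<le> 0" using assms by (simp add: divide_le_0_iff)
  with False show ?thesis by simp
qed

lemma eventually_ln_ge_1: "\<forall>\<^sub>F n in sequentially. 1 \<le> ln (real n) \<and> n \<ge> 1"
proof (rule eventually_sequentiallyI[of 3])
  fix n :: nat assume "3 \<le> n"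
  then have "exp 1 \<le> real n" using e_less_272 by simp
  with \<open>3 \<le> n\<close> show "1 \<le> ln (real n) \<and> n \<ge> 1" using ln_ge_iff[of "real n" 1] by auto
qed

text \<open>The exponent \<open>\<nu>\<close> is separate from the number \<open>i\<close> of
  logarithms actually present so that the lemma serves both for the full power and for the power
  reduced by one.\<close>

lemma err_log_power_term:
  assumes g: "C_infinity_on g {-1..1}" and a: "2 * a + \<rho> > -1" and i: "i \<le> \<nu>"
  shows "\<exists>C\<ge>0. \<forall>\<^sub>F n in sequentially.
    err (\<lambda>x. c * ln (real n powr - q) ^ i * (real n powr - q) powr a * (log_power a j (y x / real n powr - q) * g x)) n
      \<le> C * (real n powr (- q * (2 * a + \<rho> + 1)) * ln (real n) ^ (2 * \<nu>))"
proof -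
  obtain C where C: "C \<ge> 0" "\<forall>\<^sub>F n in sequentially.
      err (\<lambda>x. log_power a j (y x / real n powr - q) * g x) n \<le> C * (real n powr - q) powr (\<rho> + 1)"
    using err_log_power_scaled[OF g a, of j] by blast
  have "\<forall>\<^sub>F n in sequentially.
    err (\<lambda>x. c * ln (real n powr - q) ^ i * (real n powr - q) powr a * (log_power a j (y x / real n powr - q) * g x)) n
      \<le> (c\<^sup>2 * q ^ (2 * i) * C) * (real n powr (- q * (2 * a + \<rho> + 1)) * ln (real n) ^ (2 * \<nu>))"
    using C(2) eventually_ln_ge_1
  proof eventually_elim
    case (elim n)
    let ?e = "real n powr - q"
    have "(c * ln ?e ^ i * ?e powr a)\<^sup>2 = c\<^sup>2 * (ln ?e ^ i)\<^sup>2 * (?e powr a)\<^sup>2"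
      by (simp only: power_mult_distrib)
    also have "(ln ?e ^ i)\<^sup>2 = q ^ (2 * i) * ln (real n) ^ (2 * i)"
      using elim by (simp add: ln_powr power_mult_distrib power_mult[symmetric] mult.commute)
    also have "(?e powr a)\<^sup>2 = ?e powr (2 * a)"
      unfolding power2_eq_square powr_add[symmetric] by simp
    finally have *: "(c * ln ?e ^ i * ?e powr a)\<^sup>2 =
        c\<^sup>2 * (q ^ (2 * i) * ln (real n) ^ (2 * i)) * ?e powr (2 * a)" .
    have "ln (real n) ^ (2 * i) \<le> ln (real n) ^ (2 * \<nu>)"
      using elim i by (intro power_increasing) auto
    then have "c\<^sup>2 * (q ^ (2 * i) * ln (real n) ^ (2 * i)) * ?e powr (2 * a) * (C * ?e powr (\<rho> + 1)) \<le>
        c\<^sup>2 * (q ^ (2 * i) * ln (real n) ^ (2 * \<nu>)) * ?e powr (2 * a) * (C * ?e powr (\<rho> + 1))"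
      using C(1) q(1) by (intro mult_right_mono mult_left_mono) auto
    also have "\<dots> = (c\<^sup>2 * q ^ (2 * i) * C) * ((?e powr (2 * a) * ?e powr (\<rho> + 1)) * ln (real n) ^ (2 * \<nu>))"
      by (simp only: mult_ac)
    also have "?e powr (2 * a) * ?e powr (\<rho> + 1) = real n powr (- q * (2 * a + \<rho> + 1))"
      unfolding powr_add[symmetric] powr_powr by (simp add: algebra_simps)
    finally show ?case
      unfolding err_cmult * using elim(1) C(1) q(1)
      by (elim order_trans[rotated]) (intro mult_left_mono, auto intro!: mult_nonneg_nonneg)
  qed
  then show ?thesis using C(1) q(1)
    by (intro exI[of _ "c\<^sup>2 * q ^ (2 * i) * C"]) auto
qed

text \<open>The functions themselves vary with \<open>n\<close>, through the scale, so a bound for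
  fixed functions would not do.\<close>

lemma err_finite_sum_bound:
  fixes k :: nat
  assumes sq: "\<And>j n. j \<le> k \<Longrightarrow> n \<ge> 1 \<Longrightarrow> square_integrable M (T j n)"
    and T: "\<And>j. j \<le> k \<Longrightarrow> \<exists>C\<ge>0. \<forall>\<^sub>F n in sequentially. err (T j n) n \<le> C * F n"
  shows "\<exists>C\<ge>0. \<forall>\<^sub>F n in sequentially. err (\<lambda>x. \<Sum>j\<le>k. T j n x) n \<le> C * F n"
proof -
  have "\<forall>j\<in>{..k}. \<exists>C. C \<ge> 0 \<and> (\<forall>\<^sub>F n in sequentially. err (T j n) n \<le> C * F n)"
    using T by blast
  then obtain C where C: "\<forall>j\<in>{..k}. C j \<ge> 0 \<and> (\<forall>\<^sub>F n in sequentially. err (T j n) n \<le> C j * F n)"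
    using bchoice[of "{..k}" "\<lambda>j C. C \<ge> 0 \<and> (\<forall>\<^sub>F n in sequentially. err (T j n) n \<le> C * F n)"] by blast
  have "\<forall>\<^sub>F n in sequentially. \<forall>j\<in>{..k}. err (T j n) n \<le> C j * F n"
    using C by (intro eventually_ball_finite) auto
  then have "\<forall>\<^sub>F n in sequentially. err (\<lambda>x. \<Sum>j\<le>k. T j n x) n \<le> (2 ^ k * (\<Sum>j\<le>k. C j)) * F n"
    using eventually_ge_at_top[of 1]
  proof eventually_elim
    case (elim n)
    have "err (\<lambda>x. \<Sum>j\<le>k. T j n x) n \<le> 2 ^ k * (\<Sum>j\<le>k. err (T j n) n)"
      using elim by (intro err_sum sq) auto
    also have "\<dots> \<le> 2 ^ k * (\<Sum>j\<le>k. C j * F n)"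
      using elim by (intro mult_left_mono sum_mono) auto
    finally show ?case by (simp add: sum_distrib_right mult.assoc)
  qed
  moreover have "0 \<le> 2 ^ k * (\<Sum>j\<le>k. C j)" using C by (intro mult_nonneg_nonneg sum_nonneg) auto
  ultimately show ?thesis by blast
qed

abbreviation rescaled_term :: "(real \<Rightarrow> real) \<Rightarrow> real \<Rightarrow> nat \<Rightarrow> nat \<Rightarrow> nat \<Rightarrow> real \<Rightarrow> real" where
  "rescaled_term g a \<mu> j n x \<equiv> real (\<mu> choose j) * ln (real n powr - q) ^ (\<mu> - j) * (real n powr - q) powr a *
    (log_power a j (y x / real n powr - q) * g x)"

lemma square_integrable_rescaled_term:
  assumes "C_infinity_on g {-1..1}" "2 * a + \<rho> > -1" "n \<ge> 1"
  shows "square_integrable M (rescaled_term g a \<mu> j n)"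
  using powr_minus_q_le_1[OF assms(3)]
  by (intro square_integrable_cmult square_integrable_log_power assms(1,2)) auto

lemma err_log_power_from_terms:
  assumes g: "C_infinity_on g {-1..1}" and a: "2 * a + \<rho> > -1"
    and T: "\<And>j. j \<le> \<mu> \<Longrightarrow> \<exists>C\<ge>0. \<forall>\<^sub>F n in sequentially. err (rescaled_term g a \<mu> j n) n \<le> C * F n"
  shows "\<exists>C\<ge>0. \<forall>\<^sub>F n in sequentially. err (\<lambda>x. log_power a \<mu> (y x) * g x) n \<le> C * F n"
proof -
  obtain C where C: "C \<ge> 0" "\<forall>\<^sub>F n in sequentially. err (\<lambda>x. \<Sum>j\<le>\<mu>. rescaled_term g a \<mu> j n x) n \<le> C * F n"
    using err_finite_sum_bound[of \<mu> "rescaled_term g a \<mu>" F] T square_integrable_rescaled_term[OF g a] by blast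
  from C(2) eventually_ge_at_top[of 1]
  have "\<forall>\<^sub>F n in sequentially. err (\<lambda>x. log_power a \<mu> (y x) * g x) n \<le> C * F n"
  proof eventually_elim
    case (elim n)
    have "(\<lambda>x. log_power a \<mu> (y x) * g x) = (\<lambda>x. \<Sum>j\<le>\<mu>. rescaled_term g a \<mu> j n x)"
      using powr_minus_q_le_1[OF elim(2)]
      by (subst log_power_rescale[of "real n powr - q"]) (simp_all add: sum_distrib_right mult.assoc)
    with elim show ?case by simp
  qed
  with C(1) show ?thesis by blast
qed

lemma err_log_power:
  assumes g: "C_infinity_on g {-1..1}" and a: "2 * a + \<rho> > -1"
  shows "\<exists>C\<ge>0. \<forall>\<^sub>F n in sequentially. err (\<lambda>x. log_power a \<mu> (y x) * g x) n
    \<le> C * (real n powr (- q * (2 * a + \<rho> + 1)) * ln (real n) ^ (2 * \<mu>))"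
  by (intro err_log_power_from_terms g a err_log_power_term) auto

text \<open>The hypothesis \<open>side\<close> places the singularity at an end of the interval.
  Inside, the power cut to \<open>0\<close> on one side of \<open>z\<close> would not be smooth, and
  the term \<open>j = 0\<close> would keep all its logarithms.\<close>

lemma err_log_power_nat:
  assumes g: "C_infinity_on g {-1..1}" and a: "2 * real k + \<rho> > -1" and \<mu>: "\<mu> \<ge> 1"
    and side: "\<And>x. x \<in> {-1..1} \<Longrightarrow> 0 \<le> y x"
  shows "\<exists>C\<ge>0. \<forall>\<^sub>F n in sequentially. err (\<lambda>x. log_power (real k) \<mu> (y x) * g x) n
    \<le> C * (real n powr (- q * (2 * real k + \<rho> + 1)) * ln (real n) ^ (2 * (\<mu> - 1)))"
proof (rule err_log_power_from_terms[OF g a])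
  let ?a = "real k" and ?p = "- q * (2 * real k + \<rho> + 1)"
  fix j assume j: "j \<le> \<mu>"
  show "\<exists>C\<ge>0. \<forall>\<^sub>F n in sequentially. err (rescaled_term g ?a \<mu> j n) n
    \<le> C * (real n powr ?p * ln (real n) ^ (2 * (\<mu> - 1)))"
  proof (cases "j = 0")
    case False
    then show ?thesis by (intro err_log_power_term g a) auto
  next
    case True
    let ?h = "\<lambda>x. y x ^ k * g x"
    have h: "C_infinity_on ?h {-1..1}" by (rule C_infinity_on_linear_power_mult[OF g])
    \<comment> \<open>Ensures \<open>2 - 2 * real r \<le> ?p\<close>, where the \<open>2\<close>
      makes up for bounding two logarithms by \<open>(real n)\<^sup>2\<close>.\<close>
    obtain r :: nat where r: "real r \<ge> (2 - ?p) / 2" using real_arch_simple by blast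
    obtain C where C: "C \<ge> 0" "\<And>N. err ?h (N + r) \<le> C / (real N + 1) ^ (2 * r)"
      using smooth_err_bound[OF ab h, of r] by blast
    define D where "D = q ^ (2 * \<mu>) * C * (real r + 1) ^ (2 * r)"
    have "\<forall>\<^sub>F n in sequentially. err (rescaled_term g ?a \<mu> j n) n
        \<le> D * (real n powr ?p * ln (real n) ^ (2 * (\<mu> - 1)))"
      using eventually_ge_at_top[of r] eventually_ln_ge_1
    proof eventually_elim
      case (elim n)
      let ?e = "real n powr - q"
      have e: "0 < ?e" "?e \<le> 1" using powr_minus_q_le_1 elim by auto
      have "err (rescaled_term g ?a \<mu> j n) n = err (\<lambda>x. ln ?e ^ \<mu> * ?h x) n"
      proof (rule err_cong_AE)
        show "rescaled_term g ?a \<mu> j n \<in> borel_measurable M"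
          using elim by (intro square_integrable_measurable square_integrable_rescaled_term g a) auto
        show "(\<lambda>x. ln ?e ^ \<mu> * ?h x) \<in> borel_measurable M"
          by (intro borel_measurable_jacobi_measure_continuous continuous_on_mult continuous_on_const
              C_infinity_on_imp_continuous_on[OF h])
        \<comment> \<open>At \<open>z\<close> the two sides can differ: for \<open>k = 0\<close>,
          \<open>log_power\<close> is \<open>0\<close> there while \<open>y x ^ k\<close> is
          \<open>1\<close>.\<close>
        show "AE x in M. rescaled_term g ?a \<mu> j n x = ln ?e ^ \<mu> * ?h x"
          using AE_jacobi_measure_neq[of z \<alpha> \<beta>] AE_space
        proof eventually_elim
          case (elim x)
          have "y x \<noteq> 0" using elim(1) s by auto
          moreover have "0 \<le> y x" using elim(2) by (intro side) simp
          ultimately have yx: "y x > 0" by linarith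
          have "?e powr ?a * (y x / ?e) powr ?a = y x powr ?a"
            using powr_mult[of ?e "y x / ?e" ?a] e by simp
          moreover have "y x powr ?a = y x ^ k" using yx by (rule powr_realpow)
          moreover have "log_power ?a 0 (y x / ?e) = (y x / ?e) powr ?a"
            using yx e by (simp add: log_power_def)
          moreover have "rescaled_term g ?a \<mu> j n x = ln ?e ^ \<mu> * (?e powr ?a * log_power ?a 0 (y x / ?e)) * g x"
            unfolding True by simp
          ultimately show ?case by simp
        qed
      qed
      also have "\<dots> = (ln ?e ^ \<mu>)\<^sup>2 * err ?h n" by (rule err_cmult)
      also have "(ln ?e ^ \<mu>)\<^sup>2 = q ^ (2 * \<mu>) * ln (real n) ^ (2 * \<mu>)"
        using elim by (simp add: ln_powr power_mult_distrib power_mult[symmetric] mult.commute)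
      also have "ln (real n) ^ (2 * \<mu>) = ln (real n) ^ (2 * (\<mu> - 1)) * (ln (real n))\<^sup>2"
        unfolding power_add[symmetric] using \<mu> by (intro arg_cong2[where f="(^)"]) auto
      also have "q ^ (2 * \<mu>) * (ln (real n) ^ (2 * (\<mu> - 1)) * (ln (real n))\<^sup>2) * err ?h n \<le>
          q ^ (2 * \<mu>) * (ln (real n) ^ (2 * (\<mu> - 1)) * (real n)\<^sup>2) * (C * ((real r + 1) ^ (2 * r) / real n ^ (2 * r)))"
      proof (intro mult_mono mult_left_mono)
        show "(ln (real n))\<^sup>2 \<le> (real n)\<^sup>2"
          using elim ln_bound[of "real n"] by (intro power_mono) auto
        show "err ?h n \<le> C * ((real r + 1) ^ (2 * r) / real n ^ (2 * r))"
          using C(2)[of "n - r"] elim mult_left_mono[OF shifted_index_bound[of r n] C(1)] by simp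
      qed (use q(1) elim in \<open>auto simp: err_nonneg\<close>)
      also have "\<dots> = D * (((real n)\<^sup>2 / real n ^ (2 * r)) * ln (real n) ^ (2 * (\<mu> - 1)))"
        by (simp add: D_def)
      also have "(real n)\<^sup>2 / real n ^ (2 * r) = real n powr real 2 / real n powr real (2 * r)"
        using elim by (subst (1 2) powr_realpow) auto
      also have "\<dots> = real n powr (2 - 2 * real r)"
        unfolding powr_diff[symmetric] by simp
      also have "D * (real n powr (2 - 2 * real r) * ln (real n) ^ (2 * (\<mu> - 1))) \<le>
          D * (real n powr ?p * ln (real n) ^ (2 * (\<mu> - 1)))"
        using elim r C(1) q(1)
        by (intro mult_left_mono mult_right_mono powr_mono) (auto simp: D_def field_simps)
      finally show ?case .
    qed
    moreover have "D \<ge> 0" using C(1) q(1) by (simp add: D_def)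
    ultimately show ?thesis by blast
  qed
qed

end

section \<open>The locale at the end points and inside the interval\<close>

lemma powr_le_max:
  fixes a b x y :: real
  assumes "0 < a" "a \<le> x" "x \<le> b"
  shows "x powr p \<le> max (a powr p) (b powr p)"
proof (cases "p \<ge> 0")
  case True
  then have "x powr p \<le> b powr p" using assms by (intro powr_mono2) auto
  then show ?thesis by simp
next
  case False
  then have "x powr p \<le> a powr p" using assms by (intro powr_mono2') auto
  then show ?thesis by simp
qed

text \<open>Raising both parameters by \<open>r\<close> raises the order of the weight at
  \<open>1\<close> by \<open>r\<close>, so \<open>\<kappa> = 1\<close>, and
  \<open>q * (2 - \<kappa>) = 2\<close> forces \<open>q = 2\<close>.\<close>

lemma jacobi_one_sided_right:
  assumes ab: "\<alpha> > -1" "\<beta> > -1"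
  shows "jacobi_one_sided \<alpha> \<beta> (-1) 1 \<alpha> 1 2"
proof
  show "\<exists>W\<ge>0. \<exists>\<delta>>0. \<forall>x\<in>{-1..1}. 0 < -1 * (x - 1) \<and> -1 * (x - 1) \<le> \<delta> \<longrightarrow>
      jacobi_weight \<alpha> \<beta> x \<le> W * (-1 * (x - 1)) powr \<alpha>"
  proof (rule exI[of _ "max (1 powr \<beta>) (2 powr \<beta>)"], rule conjI)
    show "\<exists>\<delta>>0. \<forall>x\<in>{-1..1}. 0 < -1 * (x - 1) \<and> -1 * (x - 1) \<le> \<delta> \<longrightarrow>
        jacobi_weight \<alpha> \<beta> x \<le> max (1 powr \<beta>) (2 powr \<beta>) * (-1 * (x - 1)) powr \<alpha>"
    \<comment> \<open>Within distance \<open>1\<close> of the end point, \<open>1 + x\<close> lies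
      between \<open>1\<close> and \<open>2\<close>, so its power is bounded for either sign of
      \<open>\<beta>\<close>.\<close>
    proof (intro exI[of _ 1] conjI ballI impI)
    fix x :: real assume "x \<in> {-1..1}" "0 < -1 * (x - 1) \<and> -1 * (x - 1) \<le> 1"
    then have "(1 + x) powr \<beta> \<le> max (1 powr \<beta>) (2 powr \<beta>)" by (intro powr_le_max) auto
    from mult_right_mono[OF this, of "(1 - x) powr \<alpha>"]
    show "jacobi_weight \<alpha> \<beta> x \<le> max (1 powr \<beta>) (2 powr \<beta>) * (-1 * (x - 1)) powr \<alpha>"
      by (simp add: jacobi_weight_def mult.commute)
    qed simp
  qed (simp add: le_max_iff_disj)
  show "\<exists>W\<ge>0. \<forall>x\<in>{-1..1}. 0 < -1 * (x - 1) \<longrightarrow>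
      jacobi_weight (\<alpha> + real r) (\<beta> + real r) x \<le> W * (-1 * (x - 1)) powr (\<alpha> + 1 * real r)"
    if r: "- \<alpha> \<le> real r" "- \<beta> \<le> real r" for r
  proof (intro exI[of _ "2 powr (\<beta> + real r)"] conjI ballI impI)
    fix x :: real assume "x \<in> {-1..1}"
    \<comment> \<open>The shifted exponent is nonnegative, so this bound holds up to the opposite
      end.\<close>
    then have "(1 + x) powr (\<beta> + real r) \<le> 2 powr (\<beta> + real r)" using r by (intro powr_mono2) auto
    from mult_right_mono[OF this, of "(1 - x) powr (\<alpha> + real r)"]
    show "jacobi_weight (\<alpha> + real r) (\<beta> + real r) x \<le>
        2 powr (\<beta> + real r) * (-1 * (x - 1)) powr (\<alpha> + 1 * real r)"
      by (simp add: jacobi_weight_def mult.commute)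
  qed simp
qed (use ab in auto)

lemma jacobi_one_sided_left:
  assumes ab: "\<alpha> > -1" "\<beta> > -1"
  shows "jacobi_one_sided \<alpha> \<beta> 1 (-1) \<beta> 1 2"
proof
  show "\<exists>W\<ge>0. \<exists>\<delta>>0. \<forall>x\<in>{-1..1}. 0 < 1 * (x - -1) \<and> 1 * (x - -1) \<le> \<delta> \<longrightarrow>
      jacobi_weight \<alpha> \<beta> x \<le> W * (1 * (x - -1)) powr \<beta>"
  proof (rule exI[of _ "max (1 powr \<alpha>) (2 powr \<alpha>)"], rule conjI)
    show "\<exists>\<delta>>0. \<forall>x\<in>{-1..1}. 0 < 1 * (x - -1) \<and> 1 * (x - -1) \<le> \<delta> \<longrightarrow>
        jacobi_weight \<alpha> \<beta> x \<le> max (1 powr \<alpha>) (2 powr \<alpha>) * (1 * (x - -1)) powr \<beta>"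
    proof (intro exI[of _ 1] conjI ballI impI)
    fix x :: real assume "x \<in> {-1..1}" "0 < 1 * (x - -1) \<and> 1 * (x - -1) \<le> 1"
    then have "(1 - x) powr \<alpha> \<le> max (1 powr \<alpha>) (2 powr \<alpha>)" by (intro powr_le_max) auto
    from mult_right_mono[OF this, of "(1 + x) powr \<beta>"]
    show "jacobi_weight \<alpha> \<beta> x \<le> max (1 powr \<alpha>) (2 powr \<alpha>) * (1 * (x - -1)) powr \<beta>"
      by (simp add: jacobi_weight_def add.commute)
    qed simp
  qed (simp add: le_max_iff_disj)
  show "\<exists>W\<ge>0. \<forall>x\<in>{-1..1}. 0 < 1 * (x - -1) \<longrightarrow>
      jacobi_weight (\<alpha> + real r) (\<beta> + real r) x \<le> W * (1 * (x - -1)) powr (\<beta> + 1 * real r)"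
    if r: "- \<alpha> \<le> real r" "- \<beta> \<le> real r" for r
  proof (intro exI[of _ "2 powr (\<alpha> + real r)"] conjI ballI impI)
    fix x :: real assume "x \<in> {-1..1}"
    then have "(1 - x) powr (\<alpha> + real r) \<le> 2 powr (\<alpha> + real r)" using r by (intro powr_mono2) auto
    from mult_right_mono[OF this, of "(1 + x) powr (\<beta> + real r)"]
    show "jacobi_weight (\<alpha> + real r) (\<beta> + real r) x \<le>
        2 powr (\<alpha> + real r) * (1 * (x - -1)) powr (\<beta> + 1 * real r)"
      by (simp add: jacobi_weight_def add.commute)
  qed simp
qed (use ab in auto)

text \<open>Near an interior point the weight, shifted or not, is merely bounded:
  \<open>\<rho> = \<kappa> = 0\<close>, hence \<open>q = 1\<close>.\<close>

lemma jacobi_one_sided_interior: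
  assumes ab: "\<alpha> > -1" "\<beta> > -1" and z: "z \<in> {-1<..<1}" and s: "\<bar>s\<bar> = 1"
  shows "jacobi_one_sided \<alpha> \<beta> s z 0 0 1"
proof
  \<comment> \<open>Half the distance from \<open>z\<close> to the nearer end point: within
    \<open>\<delta>\<close> of \<open>z\<close>, both \<open>1 - x\<close> and \<open>1 + x\<close>
    are still at least \<open>\<delta>\<close>.\<close>
  define \<delta> where "\<delta> = (1 - \<bar>z\<bar>) / 2"
  have \<delta>: "\<delta> > 0" using z by (auto simp: \<delta>_def)
  let ?A = "max (\<delta> powr \<alpha>) (2 powr \<alpha>)" and ?B = "max (\<delta> powr \<beta>) (2 powr \<beta>)"
  show "\<exists>W\<ge>0. \<exists>\<delta>>0. \<forall>x\<in>{-1..1}. 0 < s * (x - z) \<and> s * (x - z) \<le> \<delta> \<longrightarrow>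
      jacobi_weight \<alpha> \<beta> x \<le> W * (s * (x - z)) powr 0"
  proof (rule exI[of _ "?A * ?B"], rule conjI)
    show "\<exists>\<delta>>0. \<forall>x\<in>{-1..1}. 0 < s * (x - z) \<and> s * (x - z) \<le> \<delta> \<longrightarrow>
        jacobi_weight \<alpha> \<beta> x \<le> ?A * ?B * (s * (x - z)) powr 0"
    proof (intro exI[of _ \<delta>] conjI ballI impI \<delta>)
    fix x :: real assume x: "x \<in> {-1..1}" "0 < s * (x - z) \<and> s * (x - z) \<le> \<delta>"
    then have "\<bar>x - z\<bar> \<le> \<delta>" using s by (metis abs_mult abs_of_pos mult_1)
    then have "\<delta> \<le> 1 - x" "\<delta> \<le> 1 + x" by (auto simp: \<delta>_def field_simps abs_if split: if_splits)
    then have "(1 - x) powr \<alpha> \<le> ?A" "(1 + x) powr \<beta> \<le> ?B"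
      using x \<delta> by (intro powr_le_max; simp)+
    then have "jacobi_weight \<alpha> \<beta> x \<le> ?A * ?B"
      unfolding jacobi_weight_def by (intro mult_mono) (auto simp: le_max_iff_disj)
    \<comment> \<open>The base is positive here; \<open>0 powr 0\<close> would be
      \<open>0\<close>.\<close>
    moreover have "(s * (x - z)) powr 0 = 1" using x(2) by auto
    ultimately show "jacobi_weight \<alpha> \<beta> x \<le> ?A * ?B * (s * (x - z)) powr 0"
      by (simp only: mult_1_right)
    qed
  qed (intro mult_nonneg_nonneg; simp add: le_max_iff_disj)
  show "\<exists>W\<ge>0. \<forall>x\<in>{-1..1}. 0 < s * (x - z) \<longrightarrow>
      jacobi_weight (\<alpha> + real r) (\<beta> + real r) x \<le> W * (s * (x - z)) powr (0 + 0 * real r)"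
    if r: "- \<alpha> \<le> real r" "- \<beta> \<le> real r" for r
  proof (intro exI[of _ "2 powr (\<alpha> + real r) * 2 powr (\<beta> + real r)"] conjI ballI impI)
    fix x :: real assume x: "x \<in> {-1..1}" "0 < s * (x - z)"
    have "jacobi_weight (\<alpha> + real r) (\<beta> + real r) x \<le> 2 powr (\<alpha> + real r) * 2 powr (\<beta> + real r)"
      unfolding jacobi_weight_def using x(1) r by (intro mult_mono powr_mono2) auto
    moreover have "(s * (x - z)) powr (0 + 0 * real r) = 1"
      unfolding mult_zero_left add_0 using x(2) by auto
    ultimately show "jacobi_weight (\<alpha> + real r) (\<beta> + real r) x \<le>
        2 powr (\<alpha> + real r) * 2 powr (\<beta> + real r) * (s * (x - z)) powr (0 + 0 * real r)"
      by (simp only: mult_1_right)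
  qed simp
qed (use ab s in auto)

section \<open>Passage from the squared error to the stated norm\<close>

lemma jacobi_proj_error_eq:
  assumes ab: "\<alpha> > -1" "\<beta> > -1" and f: "f \<in> borel_measurable (jacobi_measure \<alpha> \<beta>)"
  shows "jacobi_proj_error \<alpha> \<beta> f N = sqrt (jacobi_err \<alpha> \<beta> f N)"
proof -
  interpret orthogonal_system "jacobi_measure \<alpha> \<beta>" "jacobi_poly \<alpha> \<beta>"
    by (rule orthogonal_system_jacobi[OF ab])
  have P [measurable]: "jacobi_poly \<alpha> \<beta> n \<in> borel_measurable (jacobi_measure \<alpha> \<beta>)" for n
    by (intro borel_measurable_jacobi_measure_continuous continuous_intros)
  note [measurable] = f
  have c: "jacobi_coeff \<alpha> \<beta> f n = coeff f n" for n
    by (simp add: jacobi_coeff_def coeff_def jacobi_sigma_eq integral_jacobi_measure mult.assoc)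
  show ?thesis
    unfolding jacobi_proj_error_def weighted_L2_norm_def err_def jacobi_proj_def c
    by (subst integral_jacobi_measure) auto
qed

text \<open>The value of \<open>f\<close> at the singular point is arbitrary in the theorem.\<close>

lemma borel_measurable_jacobi_measure_off_point:
  assumes h: "h \<in> borel_measurable (jacobi_measure \<alpha> \<beta>)"
    and f: "\<And>x. x \<in> {-1..1} - {z} \<Longrightarrow> f x = (h x :: real)"
  shows "f \<in> borel_measurable (jacobi_measure \<alpha> \<beta>)"
proof -
  have [measurable]: "(\<lambda>x. x) \<in> borel_measurable (jacobi_measure \<alpha> \<beta>)"
    by (rule borel_measurable_jacobi_measure_borel) simp
  note [measurable] = h
  have "(\<lambda>x. if x = z then f z else h x) \<in> borel_measurable (jacobi_measure \<alpha> \<beta>)" by measurable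
  moreover have "f x = (if x = z then f z else h x)" if "x \<in> space (jacobi_measure \<alpha> \<beta>)" for x
    using f[of x] that by auto
  ultimately show ?thesis by (subst measurable_cong)
qed

lemma jacobi_proj_error_bigo:
  assumes ab: "\<alpha> > -1" "\<beta> > -1" and h: "h \<in> borel_measurable (jacobi_measure \<alpha> \<beta>)"
    and f: "\<And>x. x \<in> {-1..1} - {z} \<Longrightarrow> f x = h x"
    and bound: "\<exists>C\<ge>0. \<forall>\<^sub>F n in sequentially. jacobi_err \<alpha> \<beta> h n \<le> C * (real n powr (2 * p) * ln (real n) ^ (2 * k))"
  shows "jacobi_proj_error \<alpha> \<beta> f \<in> O(\<lambda>N. real N powr p * ln (real N) ^ k)"
proof -
  interpret orthogonal_system "jacobi_measure \<alpha> \<beta>" "jacobi_poly \<alpha> \<beta>"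
    by (rule orthogonal_system_jacobi[OF ab])
  have fm: "f \<in> borel_measurable (jacobi_measure \<alpha> \<beta>)"
    using h f by (rule borel_measurable_jacobi_measure_off_point)
  have eq: "err f n = err h n" for n
  proof (rule err_cong_AE[OF fm h])
    show "AE x in jacobi_measure \<alpha> \<beta>. f x = h x"
      using AE_jacobi_measure_neq[of z \<alpha> \<beta>] AE_space by eventually_elim (auto simp: f)
  qed
  obtain C where C: "C \<ge> 0" "\<forall>\<^sub>F n in sequentially. err h n \<le> C * (real n powr (2 * p) * ln (real n) ^ (2 * k))"
    using bound by blast
  show ?thesis
  proof (rule bigoI)
    show "\<forall>\<^sub>F n in sequentially. norm (jacobi_proj_error \<alpha> \<beta> f n) \<le> sqrt C * norm (real n powr p * ln (real n) ^ k)"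
      using C(2)
    proof eventually_elim
      case (elim n)
      have "real n powr (2 * p) = (real n powr p)\<^sup>2"
        unfolding power2_eq_square powr_add[symmetric] by simp
      moreover have "ln (real n) ^ (2 * k) = (ln (real n) ^ k)\<^sup>2"
        unfolding power_mult[symmetric] by (simp only: mult.commute)
      ultimately have "real n powr (2 * p) * ln (real n) ^ (2 * k) = (real n powr p * ln (real n) ^ k)\<^sup>2"
        by (simp only: power_mult_distrib)
      with elim have "sqrt (err h n) \<le> sqrt (C * (real n powr p * ln (real n) ^ k)\<^sup>2)"
        by simp
      then show ?case
        unfolding jacobi_proj_error_eq[OF ab fm] eq using err_nonneg[of h n]
        by (simp add: real_sqrt_mult)
    qed
  qed
qed

theorem theorem4:
  fixes \<alpha> \<beta> :: real and \<mu> :: nat and g :: "real \<Rightarrow> real"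
  assumes "\<alpha> > -1" and "\<beta> > -1" and "C_infinity_on g {-1..1}"
  shows
    "(\<forall>(f :: real \<Rightarrow> real) (\<gamma> :: real).
        min (\<alpha> + \<gamma>) (\<alpha> + 2 * \<gamma>) > -1 \<longrightarrow>
        (\<forall>x\<in>{-1..<1}. f x = (1 - x) powr \<gamma> * ln (1 - x) ^ \<mu> * g x) \<longrightarrow>
        jacobi_proj_error \<alpha> \<beta> f \<in> O(\<lambda>N. real N powr (-\<alpha> - 2 * \<gamma> - 1) * ln (real N) ^ \<mu>) \<and>
        (\<mu> \<ge> 1 \<and> \<gamma> \<in> \<nat> \<longrightarrow>
          jacobi_proj_error \<alpha> \<beta> f \<in> O(\<lambda>N. real N powr (-\<alpha> - 2 * \<gamma> - 1) * ln (real N) ^ (\<mu> - 1))))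
   \<and> (\<forall>(f :: real \<Rightarrow> real) (z0 :: real) (s :: real).
        z0 \<in> {-1<..<1} \<longrightarrow> s > -1/2 \<longrightarrow> min \<alpha> \<beta> \<ge> -1/2 \<longrightarrow>
        (\<forall>x\<in>{-1..1} - {z0}. f x = \<bar>x - z0\<bar> powr s * ln \<bar>x - z0\<bar> ^ \<mu> * g x) \<longrightarrow>
        jacobi_proj_error \<alpha> \<beta> f \<in> O(\<lambda>N. real N powr (-s - 1/2) * ln (real N) ^ \<mu>))
   \<and> (\<forall>(f :: real \<Rightarrow> real) (\<delta> :: real).
        min (\<beta> + \<delta>) (\<beta> + 2 * \<delta>) > -1 \<longrightarrow>
        (\<forall>x\<in>{-1<..1}. f x = (1 + x) powr \<delta> * ln (1 + x) ^ \<mu> * g x) \<longrightarrow>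
        jacobi_proj_error \<alpha> \<beta> f \<in> O(\<lambda>N. real N powr (-\<beta> - 2 * \<delta> - 1) * ln (real N) ^ \<mu>) \<and>
        (\<mu> \<ge> 1 \<and> \<delta> \<in> \<nat> \<longrightarrow>
          jacobi_proj_error \<alpha> \<beta> f \<in> O(\<lambda>N. real N powr (-\<beta> - 2 * \<delta> - 1) * ln (real N) ^ (\<mu> - 1))))"
proof (intro conjI allI impI)
  fix f :: "real \<Rightarrow> real" and \<gamma> :: real
  assume \<gamma>: "min (\<alpha> + \<gamma>) (\<alpha> + 2 * \<gamma>) > -1"
    and f: "\<forall>x\<in>{-1..<1}. f x = (1 - x) powr \<gamma> * ln (1 - x) ^ \<mu> * g x"
  interpret jacobi_one_sided \<alpha> \<beta> "-1" 1 \<alpha> 1 2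
    by (rule jacobi_one_sided_right[OF assms(1,2)])
  let ?h = "\<lambda>x. log_power \<gamma> \<mu> (-1 * (x - 1)) * g x"
  have a: "2 * \<gamma> + \<alpha> > -1" using \<gamma> by auto
  have h: "?h \<in> borel_measurable (jacobi_measure \<alpha> \<beta>)"
    \<comment> \<open>The scale \<open>e = 1\<close> leaves the function unscaled.\<close>
    using square_integrable_log_power[OF assms(3) a, of 1 \<mu>] by (simp add: square_integrable_def)
  have fh: "f x = ?h x" if "x \<in> {-1..1} - {1}" for x
    using f that by (auto simp: log_power_def)
  \<comment> \<open>On the left the exponent of \<open>err_log_power\<close> for
    \<open>q = 2\<close>, on the right twice the claimed exponent, since \<open>err\<close> is
    squared.\<close>
  have p: "- 2 * (2 * \<gamma> + \<alpha> + 1) = 2 * (-\<alpha> - 2 * \<gamma> - 1)" by simp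
  show "jacobi_proj_error \<alpha> \<beta> f \<in> O(\<lambda>N. real N powr (-\<alpha> - 2 * \<gamma> - 1) * ln (real N) ^ \<mu>)"
    using err_log_power[OF assms(3) a, of \<mu>] unfolding p
    by (intro jacobi_proj_error_bigo[OF assms(1,2) h fh])
  show "jacobi_proj_error \<alpha> \<beta> f \<in> O(\<lambda>N. real N powr (-\<alpha> - 2 * \<gamma> - 1) * ln (real N) ^ (\<mu> - 1))"
    if \<mu>: "\<mu> \<ge> 1 \<and> \<gamma> \<in> \<nat>"
  proof -
    obtain k where k: "\<gamma> = real k" using \<mu> by (auto elim: Nats_cases)
    have "\<exists>C\<ge>0. \<forall>\<^sub>F n in sequentially. err ?h n
        \<le> C * (real n powr (- 2 * (2 * \<gamma> + \<alpha> + 1)) * ln (real n) ^ (2 * (\<mu> - 1)))"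
      unfolding k using a \<mu> by (intro err_log_power_nat assms(3)) (auto simp: k)
    then show ?thesis unfolding p by (intro jacobi_proj_error_bigo[OF assms(1,2) h fh])
  qed
next
  fix f :: "real \<Rightarrow> real" and z0 s :: real
  assume z0: "z0 \<in> {-1<..<1}" and s: "s > -1/2" and "min \<alpha> \<beta> \<ge> -1/2"
    and f: "\<forall>x\<in>{-1..1} - {z0}. f x = \<bar>x - z0\<bar> powr s * ln \<bar>x - z0\<bar> ^ \<mu> * g x"
  interpret R: jacobi_one_sided \<alpha> \<beta> 1 z0 0 0 1
    by (rule jacobi_one_sided_interior[OF assms(1,2) z0]) simp
  interpret L: jacobi_one_sided \<alpha> \<beta> "-1" z0 0 0 1
    by (rule jacobi_one_sided_interior[OF assms(1,2) z0]) simp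
  \<comment> \<open>Each summand vanishes on one side of \<open>z0\<close>, so their sum reproduces
    the two-sided singularity.\<close>
  let ?r = "\<lambda>x. log_power s \<mu> (1 * (x - z0)) * g x" and ?l = "\<lambda>x. log_power s \<mu> (-1 * (x - z0)) * g x"
  have a: "2 * s + 0 > -1" using s by simp
  have sq: "square_integrable (jacobi_measure \<alpha> \<beta>) ?r" "square_integrable (jacobi_measure \<alpha> \<beta>) ?l"
    using R.square_integrable_log_power[OF assms(3) a, of 1 \<mu>] L.square_integrable_log_power[OF assms(3) a, of 1 \<mu>]
    by simp_all
  have fh: "f x = ?r x + ?l x" if "x \<in> {-1..1} - {z0}" for x
    using f that by (auto simp: log_power_def abs_if)
  let ?F = "\<lambda>n. real n powr (- 1 * (2 * s + 0 + 1)) * ln (real n) ^ (2 * \<mu>)"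
  obtain C where C: "C \<ge> 0" "\<forall>\<^sub>F n in sequentially. R.err ?r n \<le> C * ?F n"
    using R.err_log_power[OF assms(3) a, of \<mu>] by blast
  \<comment> \<open>\<open>L.err\<close> and \<open>R.err\<close> coincide, both being the error for
    the same Jacobi system, so \<open>err_add\<close> can combine the two sides.\<close>
  obtain D where D: "D \<ge> 0" "\<forall>\<^sub>F n in sequentially. R.err ?l n \<le> D * ?F n"
    using L.err_log_power[OF assms(3) a, of \<mu>] by blast
  have p: "- 1 * (2 * s + 0 + 1) = 2 * (- s - 1 / 2)" by simp
  from C(2) D(2)
  have "\<forall>\<^sub>F n in sequentially. R.err (\<lambda>x. ?r x + ?l x) n \<le> (2 * C + 2 * D) * ?F n"
  proof eventually_elim
    case (elim n)
    then have "2 * R.err ?r n + 2 * R.err ?l n \<le> (2 * C + 2 * D) * ?F n" by (simp add: distrib_right)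
    with R.err_add[OF sq, of n] show ?case by (rule order_trans)
  qed
  then have "\<exists>C\<ge>0. \<forall>\<^sub>F n in sequentially. R.err (\<lambda>x. ?r x + ?l x) n \<le> C * ?F n"
    using C(1) D(1) by (intro exI[of _ "2 * C + 2 * D"]) simp
  then show "jacobi_proj_error \<alpha> \<beta> f \<in> O(\<lambda>N. real N powr (- s - 1 / 2) * ln (real N) ^ \<mu>)"
    unfolding p using square_integrable_measurable[OF square_integrable_add[OF sq]] fh
    by (intro jacobi_proj_error_bigo[OF assms(1,2)])
next
  fix f :: "real \<Rightarrow> real" and \<delta> :: real
  assume \<delta>: "min (\<beta> + \<delta>) (\<beta> + 2 * \<delta>) > -1"
    and f: "\<forall>x\<in>{-1<..1}. f x = (1 + x) powr \<delta> * ln (1 + x) ^ \<mu> * g x"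
  interpret jacobi_one_sided \<alpha> \<beta> 1 "-1" \<beta> 1 2
    by (rule jacobi_one_sided_left[OF assms(1,2)])
  let ?h = "\<lambda>x. log_power \<delta> \<mu> (1 * (x - -1)) * g x"
  have a: "2 * \<delta> + \<beta> > -1" using \<delta> by auto
  have h: "?h \<in> borel_measurable (jacobi_measure \<alpha> \<beta>)"
    using square_integrable_log_power[OF assms(3) a, of 1 \<mu>] by (simp add: square_integrable_def)
  have fh: "f x = ?h x" if "x \<in> {-1..1} - {-1}" for x
    using f that by (auto simp: log_power_def add.commute)
  have p: "- 2 * (2 * \<delta> + \<beta> + 1) = 2 * (-\<beta> - 2 * \<delta> - 1)" by simp
  show "jacobi_proj_error \<alpha> \<beta> f \<in> O(\<lambda>N. real N powr (-\<beta> - 2 * \<delta> - 1) * ln (real N) ^ \<mu>)"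
    using err_log_power[OF assms(3) a, of \<mu>] unfolding p
    by (intro jacobi_proj_error_bigo[OF assms(1,2) h fh])
  show "jacobi_proj_error \<alpha> \<beta> f \<in> O(\<lambda>N. real N powr (-\<beta> - 2 * \<delta> - 1) * ln (real N) ^ (\<mu> - 1))"
    if \<mu>: "\<mu> \<ge> 1 \<and> \<delta> \<in> \<nat>"
  proof -
    obtain k where k: "\<delta> = real k" using \<mu> by (auto elim: Nats_cases)
    have "\<exists>C\<ge>0. \<forall>\<^sub>F n in sequentially. err ?h n
        \<le> C * (real n powr (- 2 * (2 * \<delta> + \<beta> + 1)) * ln (real n) ^ (2 * (\<mu> - 1)))"
      unfolding k using a \<mu> by (intro err_log_power_nat assms(3)) (auto simp: k)
    then show ?thesis unfolding p by (intro jacobi_proj_error_bigo[OF assms(1,2) h fh])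
  qed
qed

end
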